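(* Consider the multi-study covariate-augmented overdispersed Poisson factor model described in the context, with parameters $\boldsymbol\theta=(\boldsymbol\beta,\mathbf A,\mathbf B_1,\dots,\mathbf B_S,\lambda_1,\dots,\lambda_S)$ and fixed dimensions $p,d,q,q_1,\dots,q_S$. Assume: (A1) for all $s,i$, $\mathbf z_{si}$ is independent of $(\mathbf f_{si},\mathbf h_{si},\boldsymbol\varepsilon_{si})$, and $\mathrm E(\mathbf z_{si}\mathbf z_{si}^{\mathrm T})$ is positive definite; (A2) $(\mathbf A,\mathbf B_1)^{\mathrm T}(\mathbf A,\mathbf B_1)$ and $\mathbf B_s^{\mathrm T}\mathbf B_s$ for $2\le s\le S$ are all diagonal matrices with (strictly) decreasing positive diagonal entries, and in each column of $\mathbf A$ and of each $\mathbf B_s$ ($s\le S$) the first nonzero element is positive; (A3) $p-1>q+q_s$ for every $s$; (A4) for every $1\le k\le q_{\min}:=\min_s q_s$ there exist $s_1,s_2$ such that the $k$-th column of $\mathbf B_{s_1}$ differs from the $k$-th column of $\mathbf B_{s_2}$. Then the model is identifiable: if two parameter values $\boldsymbol\theta$ and $\boldsymbol\theta'$ both satisfy these conditions and (with the same law of the covariates) induce the same joint distribution of $(\mathbf x_{si},\mathbf z_{si})$ for all $s$ and $i$, then $\boldsymbol\theta=\boldsymbol\theta'$.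
   Context: Model. There are $S$ studies; study $s\in\{1,\dots,S\}$ has observations $i=1,\dots,n_s$. For each $(s,i)$ one observes a count vector $\mathbf x_{si}=(x_{si1},\dots,x_{sip})^{\mathrm T}$ and a covariate vector $\mathbf z_{si}\in\mathbb R^d$ whose first entry is the constant $1$ (intercept). Conditionally on $\mathbf y_{si}=(y_{si1},\dots,y_{sip})^{\mathrm T}$, the counts are independent with $$x_{sij}\mid y_{sij}\sim \mathrm{Poisson}\big(a_{si}\exp(y_{sij})\big),\qquad y_{sij}=\mathbf z_{si}^{\mathrm T}\boldsymbol\beta_j+\mathbf f_{si}^{\mathrm T}\boldsymbol\alpha_j+\mathbf h_{si}^{\mathrm T}\boldsymbol\gamma_{sj}+\varepsilon_{sij},\quad j=1,\dots,p,$$ where $a_{si}>0$ is a known normalization factor, $\mathbf f_{si}\sim N(\mathbf 0,\mathbf I_q)$ is the (unobserved) study-shared factor, $\mathbf h_{si}\sim N(\mathbf 0,\mathbf I_{q_s})$ is the (unobserved) study-specified factor, $\boldsymbol\varepsilon_{si}=(\varepsilon_{si1},\dots,\varepsilon_{sip})^{\mathrm T}$ has independent entries $\varepsilon_{sij}\sim N(0,\lambda_s)$ with $\lambda_s>0$, and $\mathbf f_{si},\mathbf h_{si},\boldsymbol\varepsilon_{si}$ are mutually independent. Parameters: $\boldsymbol\beta=(\boldsymbol\beta_1,\dots,\boldsymbol\beta_p)^{\mathrm T}\in\mathbb R^{p\times d}$, $\mathbf A=(\boldsymbol\alpha_1,\dots,\boldsymbol\alpha_p)^{\mathrm T}\in\mathbb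 R^{p\times q}$, $\mathbf B_s=(\boldsymbol\gamma_{s1},\dots,\boldsymbol\gamma_{sp})^{\mathrm T}\in\mathbb R^{p\times q_s}$, and $\lambda_s>0$. $(\mathbf A,\mathbf B_1)$ denotes the $p\times(q+q_1)$ matrix obtained by concatenating columns. *)

theory Defs
  imports "HOL-Probability.Probability" "Jordan_Normal_Form.Matrix"
begin

text \<open>
  Dimensions vary with the study, so a random vector of length \<open>m\<close> is a random variable with
  values in the product space over the index set \<open>{..<m}\<close>, and parameter matrices are
  \<open>real mat\<close>. Studies and observations are numbered from 1; coordinates, rows and columns are
  numbered from 0.
\<close>

abbreviation real_vec_space :: "nat \<Rightarrow> (nat \<Rightarrow> real) measure" where
  "real_vec_space m \<equiv> Pi\<^sub>M {..<m} (\<lambda>_. borel)"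

abbreviation count_vec_space :: "nat \<Rightarrow> (nat \<Rightarrow> nat) measure" where
  "count_vec_space m \<equiv> Pi\<^sub>M {..<m} (\<lambda>_. count_space UNIV)"

text \<open>The law \<open>N(0, v I)\<close> on vectors of length \<open>m\<close>; \<open>v\<close> is the variance, whereas the second
  argument of \<^const>\<open>normal_density\<close> is the standard deviation.\<close>

definition normal_vec :: "nat \<Rightarrow> real \<Rightarrow> (nat \<Rightarrow> real) measure" where
  "normal_vec m v =
     Pi\<^sub>M {..<m} (\<lambda>_. density lborel (\<lambda>t. ennreal (normal_density 0 (sqrt v) t)))"

definition pos_def_mat :: "real mat \<Rightarrow> bool" where
  "pos_def_mat W \<longleftrightarrow>
     square_mat W \<and> transpose_mat W = W \<and>
     (\<forall>v \<in> carrier_vec (dim_row W). v \<noteq> 0\<^sub>v (dim_row W) \<longrightarrow> scalar_prod v (W *\<^sub>v v) > 0)"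

definition concat_cols :: "real mat \<Rightarrow> real mat \<Rightarrow> real mat" where
  "concat_cols U V = mat (dim_row U) (dim_col U + dim_col V)
     (\<lambda>(i, j). if j < dim_col U then U $$ (i, j) else V $$ (i, j - dim_col U))"

definition decreasing_pos_diagonal :: "real mat \<Rightarrow> bool" where
  "decreasing_pos_diagonal W \<longleftrightarrow>
     diagonal_mat W \<and>
     (\<forall>k < dim_row W. W $$ (k, k) > 0) \<and>
     (\<forall>k l. k < l \<and> l < dim_row W \<longrightarrow> W $$ (l, l) < W $$ (k, k))"

definition first_nonzero_pos :: "real mat \<Rightarrow> bool" where
  "first_nonzero_pos W \<longleftrightarrow>
     (\<forall>k < dim_col W. \<forall>j < dim_row W.
        W $$ (j, k) \<noteq> 0 \<and> (\<forall>l < j. W $$ (l, k) = 0) \<longrightarrow> W $$ (j, k) > 0)"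

text \<open>Parameter values; row \<open>j\<close> of \<open>reg_coef\<close>, \<open>shared_load\<close> and \<open>study_load s\<close> is
  $\beta_j$, $\alpha_j$ and $\gamma_{sj}$, and \<open>noise_var s\<close> is $\lambda_s$. Only the
  values of \<open>study_load\<close> and \<open>noise_var\<close> at the studies \<open>1, \<dots>, S\<close> are meaningful.\<close>

record mparams =
  reg_coef :: "real mat"
  shared_load :: "real mat"
  study_load :: "nat \<Rightarrow> real mat"
  noise_var :: "nat \<Rightarrow> real"

definition log_rate ::
  "nat \<Rightarrow> nat \<Rightarrow> nat \<Rightarrow> nat \<Rightarrow> mparams \<Rightarrow> nat \<Rightarrow>
   (nat \<Rightarrow> real) \<Rightarrow> (nat \<Rightarrow> real) \<Rightarrow> (nat \<Rightarrow> real) \<Rightarrow> (nat \<Rightarrow> real) \<Rightarrow> nat \<Rightarrow> real"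
where
  "log_rate p d q m \<theta> s zc fc hc ec = (\<lambda>j\<in>{..<p}.
     (\<Sum>k<d. zc k * reg_coef \<theta> $$ (j, k)) +
     (\<Sum>k<q. fc k * shared_load \<theta> $$ (j, k)) +
     (\<Sum>k<m. hc k * study_load \<theta> s $$ (j, k)) + ec j)"

locale multi_study_poisson_factor_model = prob_space M
  for M :: "'w measure" +
  fixes S :: nat and n :: "nat \<Rightarrow> nat"
    and p d q :: nat and qs :: "nat \<Rightarrow> nat"
    and a :: "nat \<Rightarrow> nat \<Rightarrow> real"
    and \<theta> :: mparams
    and z f h e :: "nat \<Rightarrow> nat \<Rightarrow> 'w \<Rightarrow> nat \<Rightarrow> real"
    and x :: "nat \<Rightarrow> nat \<Rightarrow> 'w \<Rightarrow> nat \<Rightarrow> nat"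
  assumes studies: "1 \<le> S"
    and observations: "\<And>s. s \<in> {1..S} \<Longrightarrow> 1 \<le> n s"
    and covariate_dim: "1 \<le> d"
    and normalization: "\<And>s i. s \<in> {1..S} \<Longrightarrow> i \<in> {1..n s} \<Longrightarrow> 0 < a s i"
    and reg_coef_dim: "reg_coef \<theta> \<in> carrier_mat p d"
    and shared_load_dim: "shared_load \<theta> \<in> carrier_mat p q"
    and study_load_dim: "\<And>s. s \<in> {1..S} \<Longrightarrow> study_load \<theta> s \<in> carrier_mat p (qs s)"
    and noise_var_pos: "\<And>s. s \<in> {1..S} \<Longrightarrow> 0 < noise_var \<theta> s"
    and covariate_rv: "\<And>s i. s \<in> {1..S} \<Longrightarrow> i \<in> {1..n s} \<Longrightarrow>
      random_variable (real_vec_space d) (z s i)"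
    and intercept: "\<And>s i \<omega>. s \<in> {1..S} \<Longrightarrow> i \<in> {1..n s} \<Longrightarrow> \<omega> \<in> space M \<Longrightarrow> z s i \<omega> 0 = 1"
    and count_rv: "\<And>s i. s \<in> {1..S} \<Longrightarrow> i \<in> {1..n s} \<Longrightarrow>
      random_variable (count_vec_space p) (x s i)"
    and latent_indep: "\<And>s i. s \<in> {1..S} \<Longrightarrow> i \<in> {1..n s} \<Longrightarrow>
      indep_vars (\<lambda>r. real_vec_space ([q, qs s, p] ! r)) (\<lambda>r. [f s i, h s i, e s i] ! r) {..<3}"
    and shared_factor_law: "\<And>s i. s \<in> {1..S} \<Longrightarrow> i \<in> {1..n s} \<Longrightarrow>
      distr M (real_vec_space q) (f s i) = normal_vec q 1"
    and study_factor_law: "\<And>s i. s \<in> {1..S} \<Longrightarrow> i \<in> {1..n s} \<Longrightarrow>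
      distr M (real_vec_space (qs s)) (h s i) = normal_vec (qs s) 1"
    and noise_law: "\<And>s i. s \<in> {1..S} \<Longrightarrow> i \<in> {1..n s} \<Longrightarrow>
      distr M (real_vec_space p) (e s i) = normal_vec p (noise_var \<theta> s)"
    \<comment> \<open>The conditioning is on \<open>(y, z)\<close>, not on \<open>y\<close> alone: the covariates act on the counts only
      through \<open>y\<close>. Without this the model would not determine the joint law of \<open>(x, z)\<close>.\<close>
    and count_conditional_law: "\<And>s i c. s \<in> {1..S} \<Longrightarrow> i \<in> {1..n s} \<Longrightarrow>
      (let y = (\<lambda>\<omega>. log_rate p d q (qs s) \<theta> s (z s i \<omega>) (f s i \<omega>) (h s i \<omega>) (e s i \<omega>));
           F = vimage_algebra (space M) (\<lambda>\<omega>. (y \<omega>, z s i \<omega>))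
                 (real_vec_space p \<Otimes>\<^sub>M real_vec_space d)
       in AE \<omega> in M.
            real_cond_exp M F (indicator {\<omega> \<in> space M. \<forall>j<p. x s i \<omega> j = c j}) \<omega> =
            (\<Prod>j<p. pmf (poisson_pmf (a s i * exp (y \<omega> j))) (c j)))"

locale identifiability_conditions = multi_study_poisson_factor_model +
  \<comment> \<open>Independence is stated on the generated sigma-algebras because \<^const>\<open>indep_var\<close> requires
    both variables to have values in the same type.\<close>
  assumes A1_indep: "\<And>s i. s \<in> {1..S} \<Longrightarrow> i \<in> {1..n s} \<Longrightarrow>
      indep_set (sets (vimage_algebra (space M) (z s i) (real_vec_space d)))
        (sets (vimage_algebra (space M) (\<lambda>\<omega>. (f s i \<omega>, h s i \<omega>, e s i \<omega>))
          (real_vec_space q \<Otimes>\<^sub>M real_vec_space (qs s) \<Otimes>\<^sub>M real_vec_space p)))"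
    and A1_second_moments: "\<And>s i k l. s \<in> {1..S} \<Longrightarrow> i \<in> {1..n s} \<Longrightarrow> k < d \<Longrightarrow> l < d \<Longrightarrow>
      integrable M (\<lambda>\<omega>. z s i \<omega> k * z s i \<omega> l)"
    and A1_pos_def: "\<And>s i. s \<in> {1..S} \<Longrightarrow> i \<in> {1..n s} \<Longrightarrow>
      pos_def_mat (mat d d (\<lambda>(k, l). expectation (\<lambda>\<omega>. z s i \<omega> k * z s i \<omega> l)))"
    and A2_joint: "let W = concat_cols (shared_load \<theta>) (study_load \<theta> 1)
      in decreasing_pos_diagonal (transpose_mat W * W)"
    and A2_study: "\<And>s. s \<in> {2..S} \<Longrightarrow>
      decreasing_pos_diagonal (transpose_mat (study_load \<theta> s) * study_load \<theta> s)"
    and A2_sign_shared: "first_nonzero_pos (shared_load \<theta>)"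
    and A2_sign_study: "\<And>s. s \<in> {1..S} \<Longrightarrow> first_nonzero_pos (study_load \<theta> s)"
    and A3: "\<And>s. s \<in> {1..S} \<Longrightarrow> q + qs s < p - 1"
    and A4: "\<And>k. k < Min (qs ` {1..S}) \<Longrightarrow>
      \<exists>s1 \<in> {1..S}. \<exists>s2 \<in> {1..S}. col (study_load \<theta> s1) k \<noteq> col (study_load \<theta> s2) k"

end

theory Submission
  imports Defs "Jordan_Normal_Form.Determinant"
begin

text \<open>
  Conditionally on \<open>z\<close>, the mixed factorial moment of order \<open>r = (r\<^sub>1, \<dots>, r\<^sub>p)\<close> of the counts is
  \<open>a\<close> to the power \<open>\<Sum>r\<^sub>j\<close> times \<open>exp (r\<^sup>T \<beta> z + r\<^sup>T \<Sigma> r / 2)\<close>, with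
  \<open>\<Sigma> = A A\<^sup>T + B\<^sub>s B\<^sub>s\<^sup>T + \<lambda>\<^sub>s I\<close>, because the latent vector is
  Gaussian. Hence the joint law determines the polynomial \<open>r\<^sup>T \<beta> z + r\<^sup>T \<Sigma> r / 2\<close> in \<open>r\<close> for
  almost every \<open>z\<close>; its quadratic part is \<open>\<Sigma>\<close>, and its linear part gives \<open>\<beta>\<close> since the second
  moment matrix of \<open>z\<close> is positive definite. As \<open>q + q\<^sub>s < p\<close>, the smallest eigenvalue of
  \<open>\<Sigma>\<close> is \<open>\<lambda>\<^sub>s\<close>. A matrix \<open>W\<close> with orthogonal columns of strictly decreasing positive
  norms is determined by \<open>W W\<^sup>T\<close> up to the signs of its columns; this recovers \<open>(A, B\<^sub>1)\<close> from study 1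
  and then every other \<open>B\<^sub>s\<close>.
\<close>

subsection \<open>Matrices\<close>

text \<open>The m < p homogeneous equations are padded with zero rows to a square matrix, which is
  singular and therefore has a nonzero kernel vector. Applied to the loadings, this yields a
  direction invisible to all factors.\<close>

lemma wide_matrix_kernel:
  fixes c :: "nat \<Rightarrow> nat \<Rightarrow> 'a::field"
  assumes "m < p"
  obtains r where "\<exists>j<p. r j \<noteq> 0" "\<And>k. k < m \<Longrightarrow> (\<Sum>j<p. r j * c j k) = 0"
proof -
  define P where "P = mat p p (\<lambda>(i, j). if i < m then c j i else 0)"
  have P: "P \<in> carrier_mat p p" by (simp add: P_def)
  \<comment> \<open>Row p - 1 of \<open>P\<close> is padding, since m <= p - 1. Thus the last unit
    vector lies in the kernel of the transpose and the determinant vanishes.\<close>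
  have "transpose_mat P *\<^sub>v unit_vec p (p - 1) = 0\<^sub>v p"
    using assms by (intro eq_vecI) (auto simp: P_def scalar_prod_def unit_vec_def intro!: sum.neutral)
  moreover have "unit_vec p (p - 1) \<noteq> (0\<^sub>v p :: 'a vec)"
  proof
    assume "unit_vec p (p - 1) = (0\<^sub>v p :: 'a vec)"
    then have "unit_vec p (p - 1) $ (p - 1) = (0\<^sub>v p :: 'a vec) $ (p - 1)" by (rule arg_cong)
    then show False using assms by simp
  qed
  ultimately have "Determinant.det (transpose_mat P) = 0"
    using det_0_iff_vec_prod_zero_field[of "transpose_mat P" p] P by (metis transpose_carrier_mat unit_vec_carrier)
  then have "Determinant.det P = 0" using det_transpose[OF P] by simp
  then obtain v where v: "v \<in> carrier_vec p" "v \<noteq> 0\<^sub>v p" "P *\<^sub>v v = 0\<^sub>v p"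
    using det_0_iff_vec_prod_zero_field[OF P] by blast
  show thesis
  proof
    show "\<exists>j<p. v $ j \<noteq> 0" using v(1,2) by (metis carrier_vecD eq_vecI index_zero_vec)
    fix k assume k: "k < m"
    have "(P *\<^sub>v v) $ k = 0" using v(3) k assms by simp
    then show "(\<Sum>j<p. v $ j * c j k) = 0"
      using k assms v(1) by (simp add: P_def scalar_prod_def lessThan_atLeast0 mult.commute)
  qed
qed

text \<open>After negation both sequences become strictly sorted lists with the same set of entries,
  and a finite set has only one such list.\<close>

lemma strict_decreasing_image_unique:
  fixes c c' :: "nat \<Rightarrow> real"
  assumes "\<And>k l. k < l \<Longrightarrow> l < m \<Longrightarrow> c l < c k" "\<And>k l. k < l \<Longrightarrow> l < m \<Longrightarrow> c' l < c' k"
    and "c ` {..<m} = c' ` {..<m}" and "k < m"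
  shows "c k = c' k"
proof -
  have "map (\<lambda>k. - c k) [0..<m] = map (\<lambda>k. - c' k) [0..<m]"
  proof (rule strict_sorted_equal)
    have "(\<lambda>k. - c k) ` {..<m} = uminus ` c ` {..<m}" "(\<lambda>k. - c' k) ` {..<m} = uminus ` c' ` {..<m}"
      by (auto simp: image_image)
    with assms(3) show "set (map (\<lambda>k. - c k) [0..<m]) = set (map (\<lambda>k. - c' k) [0..<m])"
      by (simp add: lessThan_atLeast0)
  qed (use assms(1,2) in \<open>auto simp: sorted_wrt_iff_nth_less\<close>)
  with \<open>k < m\<close> show ?thesis by simp
qed

lemma mult_transpose_index:
  assumes "W \<in> carrier_mat p m" "j < p" "l < p"
  shows "(W * transpose_mat W) $$ (j, l) = (\<Sum>k<m. W $$ (j, k) * W $$ (l, k))"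
  using assms by (simp add: scalar_prod_def lessThan_atLeast0)

lemma transpose_mult_index:
  assumes "W \<in> carrier_mat p m" "W' \<in> carrier_mat p m" "k < m" "l < m"
  shows "(transpose_mat W * W') $$ (k, l) = (\<Sum>j<p. W $$ (j, k) * W' $$ (j, l))"
  using assms by (simp add: scalar_prod_def lessThan_atLeast0)

lemma diagonal_mult_left_index:
  fixes D X :: "real mat"
  assumes "D \<in> carrier_mat m m" "X \<in> carrier_mat m n" "diagonal_mat D" "k < m" "l < n"
  shows "(D * X) $$ (k, l) = D $$ (k, k) * X $$ (k, l)"
proof -
  have "(D * X) $$ (k, l) = (\<Sum>i<m. D $$ (k, i) * X $$ (i, l))"
    using assms by (simp add: scalar_prod_def lessThan_atLeast0)
  also have "\<dots> = (\<Sum>i<m. if i = k then D $$ (k, k) * X $$ (k, l) else 0)"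
    using assms by (intro sum.cong) (auto simp: diagonal_mat_def)
  finally show ?thesis using assms by simp
qed

lemma diagonal_mult_right_index:
  fixes D X :: "real mat"
  assumes "D \<in> carrier_mat m m" "X \<in> carrier_mat n m" "diagonal_mat D" "k < n" "l < m"
  shows "(X * D) $$ (k, l) = X $$ (k, l) * D $$ (l, l)"
proof -
  have "(X * D) $$ (k, l) = (\<Sum>i<m. X $$ (k, i) * D $$ (i, l))"
    using assms by (simp add: scalar_prod_def lessThan_atLeast0)
  also have "\<dots> = (\<Sum>i<m. if i = l then X $$ (k, l) * D $$ (l, l) else 0)"
    using assms by (intro sum.cong) (auto simp: diagonal_mat_def)
  finally show ?thesis using assms by simp
qed

text \<open>The cross product N = W^T W' intertwines the diagonal matrices W^T W and W'^T W', and N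
  N^T and N^T N are their squares. Since the diagonal entries are distinct and ordered, N is
  diagonal with entries plus or minus those of W^T W. So the columns agree up to sign, and the sign
  convention settles the rest.\<close>

lemma gram_factor_unique:
  assumes W: "W \<in> carrier_mat p m" and W': "W' \<in> carrier_mat p m"
    and gram: "W * transpose_mat W = W' * transpose_mat W'"
    and D: "decreasing_pos_diagonal (transpose_mat W * W)"
    and D': "decreasing_pos_diagonal (transpose_mat W' * W')"
    and sgn: "first_nonzero_pos W" and sgn': "first_nonzero_pos W'"
  shows "W = W'"
proof -
  define T where "T = transpose_mat W"
  define T' where "T' = transpose_mat W'"
  define N where "N = T * W'"
  define dd where "dd k = (T * W) $$ (k, k)" for k
  define dd' where "dd' k = (T' * W') $$ (k, k)" for k
  have T: "T \<in> carrier_mat m p" and T': "T' \<in> carrier_mat m p"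
    using W W' by (auto simp: T_def T'_def)
  have N: "N \<in> carrier_mat m m" using T W' by (simp add: N_def)
  have TW: "T * W \<in> carrier_mat m m" and TW': "T' * W' \<in> carrier_mat m m"
    using T T' W W' by auto
  have diag: "diagonal_mat (T * W)" and pos: "\<And>k. k < m \<Longrightarrow> 0 < dd k"
    and dec: "\<And>k l. k < l \<Longrightarrow> l < m \<Longrightarrow> dd l < dd k"
    using D TW unfolding decreasing_pos_diagonal_def dd_def T_def[symmetric] by auto
  have diag': "diagonal_mat (T' * W')" and pos': "\<And>k. k < m \<Longrightarrow> 0 < dd' k"
    and dec': "\<And>k l. k < l \<Longrightarrow> l < m \<Longrightarrow> dd' l < dd' k"
    using D' TW' unfolding decreasing_pos_diagonal_def dd'_def T'_def[symmetric] by auto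
  have G: "W * T = W' * T'" using gram by (simp add: T_def T'_def)
  have tN: "transpose_mat N = T' * W"
    unfolding N_def T_def T'_def using W W' by (simp add: transpose_mult[of _ m p _ m])
  \<comment> \<open>Regrouping exposes the factor \<open>W * T\<close>, which the Gram hypothesis
    turns into \<open>W' * T'\<close>. The next two identities use the same exchange.\<close>
  have "(T * W) * N = T * (W * T) * W'"
    unfolding N_def using T W W' by (simp add: assoc_mult_mat[of _ m p _ m _ m] assoc_mult_mat[of _ m p _ p _ m] assoc_mult_mat[of _ p m _ p _ m])
  also have "\<dots> = N * (T' * W')"
    unfolding N_def G using T W W' T' by (simp add: assoc_mult_mat[of _ m p _ m _ m] assoc_mult_mat[of _ m p _ p _ m] assoc_mult_mat[of _ p m _ p _ m])
  finally have comm: "(T * W) * N = N * (T' * W')" .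
  \<comment> \<open>Consequently a nonzero entry of \<open>N\<close> at (k, l) forces
    \<open>dd k = dd' l\<close>.\<close>
  have dN: "dd k * N $$ (k, l) = N $$ (k, l) * dd' l" if "k < m" "l < m" for k l
    using arg_cong[OF comm, of "\<lambda>X. X $$ (k, l)"] that
    by (simp add: diagonal_mult_left_index[OF TW N diag] diagonal_mult_right_index[OF TW' N diag'] dd_def dd'_def del: index_mult_mat)
  have "N * transpose_mat N = T * (W' * T') * W"
    unfolding tN unfolding N_def using T W W' T' by (simp add: assoc_mult_mat[of _ m p _ m _ m] assoc_mult_mat[of _ m p _ p _ m] assoc_mult_mat[of _ p m _ p _ m])
  also have "\<dots> = (T * W) * (T * W)"
    unfolding G[symmetric] using T W W' T' by (simp add: assoc_mult_mat[of _ m p _ m _ m] assoc_mult_mat[of _ m p _ p _ m] assoc_mult_mat[of _ p m _ p _ m])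
  finally have NN: "N * transpose_mat N = (T * W) * (T * W)" .
  have "transpose_mat N * N = T' * (W * T) * W'"
    unfolding tN unfolding N_def using T W W' T' by (simp add: assoc_mult_mat[of _ m p _ m _ m] assoc_mult_mat[of _ m p _ p _ m] assoc_mult_mat[of _ p m _ p _ m])
  also have "\<dots> = (T' * W') * (T' * W')"
    unfolding G using T W W' T' by (simp add: assoc_mult_mat[of _ m p _ m _ m] assoc_mult_mat[of _ m p _ p _ m] assoc_mult_mat[of _ p m _ p _ m])
  finally have NN': "transpose_mat N * N = (T' * W') * (T' * W')" .
  have row: "(\<Sum>l<m. (N $$ (k, l))\<^sup>2) = (dd k)\<^sup>2" if "k < m" for k
    using arg_cong[OF NN, of "\<lambda>X. X $$ (k, k)"] that mult_transpose_index[OF N, of k k]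
    by (simp add: diagonal_mult_left_index[OF TW TW diag] dd_def power2_eq_square del: index_mult_mat)
  have col: "(\<Sum>l<m. (N $$ (l, k))\<^sup>2) = (dd' k)\<^sup>2" if "k < m" for k
    using arg_cong[OF NN', of "\<lambda>X. X $$ (k, k)"] that transpose_mult_index[OF N N, of k k]
    by (simp add: diagonal_mult_left_index[OF TW' TW' diag'] dd'_def power2_eq_square del: index_mult_mat)
  \<comment> \<open>Row k of \<open>N\<close> has squared norm \<open>(dd k)\<close> squared, which
    is positive, so it contains a nonzero entry; columns are treated in the same way below.\<close>
  have "dd k \<in> dd' ` {..<m}" if "k < m" for k
  proof -
    have "(\<Sum>l<m. (N $$ (k, l))\<^sup>2) \<noteq> 0" using row[OF that] pos[OF that] by simp
    then obtain l where "l < m" "N $$ (k, l) \<noteq> 0" by (auto elim!: sum.not_neutral_contains_not_neutral)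
    with dN[OF that] have "dd k = dd' l" by auto
    with \<open>l < m\<close> show ?thesis by auto
  qed
  moreover have "dd' l \<in> dd ` {..<m}" if "l < m" for l
  proof -
    have "(\<Sum>k<m. (N $$ (k, l))\<^sup>2) \<noteq> 0" using col[OF that] pos'[OF that] by simp
    then obtain k where "k < m" "N $$ (k, l) \<noteq> 0" by (auto elim!: sum.not_neutral_contains_not_neutral)
    with dN[of k l] that have "dd' l = dd k" by auto
    with \<open>k < m\<close> show ?thesis by auto
  qed
  ultimately have img: "dd ` {..<m} = dd' ` {..<m}" by blast
  have dd_eq: "dd k = dd' k" if "k < m" for k
    using dec dec' img that by (rule strict_decreasing_image_unique)
  have off: "N $$ (k, l) = 0" if "k < m" "l < m" "k \<noteq> l" for k l
  proof -
    have "dd k \<noteq> dd l"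
      using dec[of k l] dec[of l k] that by (cases k l rule: linorder_cases) fastforce+
    then show ?thesis using dN[OF that(1,2)] dd_eq[OF that(2)] by (simp add: mult.commute)
  qed
  have diagN: "diagonal_mat N" using N off by (auto simp: diagonal_mat_def)
  \<comment> \<open>This carries the information on \<open>N\<close> back to the factors: column k
    of \<open>W'\<close> scaled by \<open>dd k\<close> is column k of \<open>W\<close> scaled by the
    diagonal entry of \<open>N\<close>.\<close>
  have "W' * (T' * W') = W' * T' * W'"
    using W' T' by (simp add: assoc_mult_mat[of _ p m _ p _ m])
  also have "\<dots> = W * N"
    unfolding N_def G[symmetric] using W W' T by (simp add: assoc_mult_mat[of _ p m _ p _ m])
  finally have WN: "W' * (T' * W') = W * N" .
  have cols: "W' $$ (j, k) * dd k = W $$ (j, k) * N $$ (k, k)" if "j < p" "k < m" for j k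
  proof -
    have "W' $$ (j, k) * dd' k = (W' * (T' * W')) $$ (j, k)"
      unfolding dd'_def by (rule diagonal_mult_right_index[OF TW' W' diag' that, symmetric])
    also have "\<dots> = W $$ (j, k) * N $$ (k, k)"
      unfolding WN by (rule diagonal_mult_right_index[OF N W diagN that])
    finally show ?thesis using dd_eq[OF that(2)] by simp
  qed
  have "W' $$ (j, k) = W $$ (j, k)" if jk: "j < p" "k < m" for j k
  proof -
    have "(\<Sum>l<m. (N $$ (k, l))\<^sup>2) = (\<Sum>l<m. if l = k then (N $$ (k, k))\<^sup>2 else 0)"
      using off jk by (intro sum.cong) auto
    then have "(N $$ (k, k))\<^sup>2 = (dd k)\<^sup>2" using row jk by simp
    then have pm: "N $$ (k, k) = dd k \<or> N $$ (k, k) = - dd k" by (simp add: power2_eq_iff)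
    \<comment> \<open>With the minus sign, column k of \<open>W'\<close> would be the negative of
      column k of \<open>W\<close>. Both columns would have their first nonzero entry in the same
      row, and it would have to be positive in both. Such an entry exists because
      \<open>dd k\<close> is positive.\<close>
    have "N $$ (k, k) \<noteq> - dd k"
    proof
      assume "N $$ (k, k) = - dd k"
      then have neg: "W' $$ (i, k) = - W $$ (i, k)" if "i < p" for i
      proof -
        have "(W' $$ (i, k) + W $$ (i, k)) * dd k = 0"
          using cols[OF that jk(2)] \<open>N $$ (k, k) = - dd k\<close> by (simp add: distrib_right)
        then show ?thesis using pos[OF jk(2)] by simp
      qed
      have "(\<Sum>i<p. W $$ (i, k) * W $$ (i, k)) \<noteq> 0"
        using pos[OF jk(2)] transpose_mult_index[OF W W jk(2) jk(2)] by (simp add: dd_def T_def)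
      then have ex: "\<exists>i. i < p \<and> W $$ (i, k) \<noteq> 0" by (auto elim!: sum.not_neutral_contains_not_neutral)
      define i where "i = (LEAST i. i < p \<and> W $$ (i, k) \<noteq> 0)"
      have i: "i < p" "W $$ (i, k) \<noteq> 0" using LeastI_ex[OF ex] by (auto simp: i_def)
      have less: "W $$ (l, k) = 0" if "l < i" for l
        using not_less_Least[of l "\<lambda>i. i < p \<and> W $$ (i, k) \<noteq> 0"] that i(1) by (auto simp: i_def)
      have "W $$ (i, k) > 0" using sgn W i less jk(2) unfolding first_nonzero_pos_def by auto
      moreover have "W' $$ (i, k) > 0"
        using sgn' W' i less jk(2) neg unfolding first_nonzero_pos_def by auto
      ultimately show False using neg[OF i(1)] by simp
    qed
    with pm cols[OF jk] pos[OF jk(2)] show ?thesis by auto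
  qed
  then show ?thesis using W W' by (intro eq_matI) auto
qed

subsection \<open>Poisson and Gaussian moments\<close>

text \<open>The falling factorial k (k - 1) ... (k - r + 1), with the order r as first argument. Its
  Poisson expectation is a pure power of the mean, so it turns counts directly into exponentials of
  the log rates.\<close>

definition ffact :: "nat \<Rightarrow> nat \<Rightarrow> real" where
  "ffact r k = (if r \<le> k then fact k / fact (k - r) else 0)"

lemma ffact_nonneg [simp]: "0 \<le> ffact r k"
  by (simp add: ffact_def)

text \<open>Shifting the summation index by r cancels the factorials and leaves the exponential
  series times mu^r exp(-mu); the terms below r are zero.\<close>

lemma poisson_factorial_moment:
  assumes "0 < \<mu>"
  shows "(\<integral>\<^sup>+k. ennreal (ffact r k * pmf (poisson_pmf \<mu>) k) \<partial>count_space UNIV) = ennreal (\<mu> ^ r)"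
proof -
  let ?t = "\<lambda>k. ffact r k * pmf (poisson_pmf \<mu>) k"
  have "(\<lambda>k. \<mu> ^ r * exp (- \<mu>) * (\<mu> ^ k / fact k)) sums (\<mu> ^ r * exp (- \<mu>) * exp \<mu>)"
    using exp_converges[of \<mu>] by (intro sums_mult) (simp add: field_simps scaleR_conv_of_real)
  also have "(\<lambda>k. \<mu> ^ r * exp (- \<mu>) * (\<mu> ^ k / fact k)) = (\<lambda>k. ?t (k + r))"
    using assms by (auto simp: fun_eq_iff ffact_def power_add)
  also have "\<mu> ^ r * exp (- \<mu>) * exp \<mu> = \<mu> ^ r" by (simp add: exp_minus)
  finally have "?t sums (\<mu> ^ r + (\<Sum>k<r. ?t k))" by (rule sums_iff_shift[of ?t r, THEN iffD1])
  also have "(\<Sum>k<r. ?t k) = 0" by (simp add: ffact_def)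
  finally have t: "?t sums \<mu> ^ r" by simp
  have "(\<Sum>k. ennreal (?t k)) = ennreal (\<mu> ^ r)"
    using t by (intro suminf_ennreal_eq) auto
  then show ?thesis by (simp only: nn_integral_count_space_nat)
qed

text \<open>Completing the square: tilting the N(0, v) density by exp(u t) gives the N(u v, v)
  density, of total mass 1, times the stated constant.\<close>

lemma normal_exponential_moment:
  assumes "0 < v"
  shows "(\<integral>\<^sup>+t. ennreal (exp (u * t)) \<partial>density lborel (\<lambda>t. ennreal (normal_density 0 (sqrt v) t)))
    = ennreal (exp (u\<^sup>2 * v / 2))"
proof -
  have shift: "normal_density 0 (sqrt v) t * exp (u * t) = exp (u\<^sup>2 * v / 2) * normal_density (u * v) (sqrt v) t" for t
  proof -
    have "- (t - 0)\<^sup>2 / (2 * (sqrt v)\<^sup>2) + u * t = u\<^sup>2 * v / 2 + - (t - u * v)\<^sup>2 / (2 * (sqrt v)\<^sup>2)"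
      using assms by (simp add: field_simps power2_eq_square)
    then have "exp (- (t - 0)\<^sup>2 / (2 * (sqrt v)\<^sup>2)) * exp (u * t) =
      exp (u\<^sup>2 * v / 2) * exp (- (t - u * v)\<^sup>2 / (2 * (sqrt v)\<^sup>2))"
      by (simp only: exp_add[symmetric])
    then show ?thesis unfolding normal_density_def by (simp del: real_sqrt_pow2_iff)
  qed
  interpret prob_space "density lborel (\<lambda>t. ennreal (normal_density (u * v) (sqrt v) t))"
    using assms by (intro prob_space_normal_density) simp
  have "(\<integral>\<^sup>+t. ennreal (exp (u * t)) \<partial>density lborel (\<lambda>t. ennreal (normal_density 0 (sqrt v) t)))
    = (\<integral>\<^sup>+t. ennreal (exp (u\<^sup>2 * v / 2)) * ennreal (normal_density (u * v) (sqrt v) t) \<partial>lborel)"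
    by (subst nn_integral_density) (simp_all add: ennreal_mult[symmetric] shift)
  also have "\<dots> = ennreal (exp (u\<^sup>2 * v / 2)) * (\<integral>\<^sup>+t. ennreal (normal_density (u * v) (sqrt v) t) \<partial>lborel)"
    by (rule nn_integral_cmult) simp
  also have "(\<integral>\<^sup>+t. ennreal (normal_density (u * v) (sqrt v) t) \<partial>lborel) = 1"
    using emeasure_space_1 by (simp add: emeasure_density)
  finally show ?thesis by simp
qed

lemma normal_vec_exponential_moment:
  assumes "0 < v"
  shows "(\<integral>\<^sup>+t. ennreal (exp (\<Sum>k<m. t k * u k)) \<partial>normal_vec m v)
    = ennreal (exp (v * (\<Sum>k<m. (u k)\<^sup>2) / 2))"
proof -
  let ?N = "density lborel (\<lambda>t. ennreal (normal_density 0 (sqrt v) t))"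
  interpret N: prob_space ?N
    using assms by (intro prob_space_normal_density) simp
  interpret product_sigma_finite "\<lambda>_::nat. ?N" by standard
  have "(\<integral>\<^sup>+t. ennreal (exp (\<Sum>k<m. t k * u k)) \<partial>normal_vec m v)
    = (\<integral>\<^sup>+t. (\<Prod>k<m. ennreal (exp (u k * t k))) \<partial>normal_vec m v)"
    by (simp add: exp_sum prod_ennreal mult.commute)
  also have "\<dots> = (\<Prod>k<m. ennreal (exp ((u k)\<^sup>2 * v / 2)))"
    unfolding normal_vec_def by (subst product_nn_integral_prod) (simp_all add: normal_exponential_moment assms)
  also have "\<dots> = ennreal (exp (v * (\<Sum>k<m. (u k)\<^sup>2) / 2))"
    by (simp add: prod_ennreal exp_sum[symmetric] sum_distrib_left sum_divide_distrib mult.commute)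
  finally show ?thesis .
qed

text \<open>Composition with \<open>u\<close> and \<open>v\<close> brings variables of different
  types into \<open>ennreal\<close>, where the product rule for independent families applies.
  Independence is assumed on generated sigma-algebras to match (A1).\<close>

lemma (in prob_space) nn_integral_mult_indep_vimage:
  fixes u v :: "_ \<Rightarrow> ennreal"
  assumes ind: "indep_set (sets (vimage_algebra (space M) X K)) (sets (vimage_algebra (space M) Y L))"
    and "X \<in> space M \<rightarrow> space K" "Y \<in> space M \<rightarrow> space L"
    and u: "u \<in> borel_measurable K" and v: "v \<in> borel_measurable L"
  shows "(\<integral>\<^sup>+\<omega>. u (X \<omega>) * v (Y \<omega>) \<partial>M) = (\<integral>\<^sup>+\<omega>. u (X \<omega>) \<partial>M) * (\<integral>\<^sup>+\<omega>. v (Y \<omega>) \<partial>M)"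
proof -
  let ?FX = "vimage_algebra (space M) X K" and ?FY = "vimage_algebra (space M) Y L"
  have FX: "(\<lambda>\<omega>. u (X \<omega>)) \<in> borel_measurable ?FX" and FY: "(\<lambda>\<omega>. v (Y \<omega>)) \<in> borel_measurable ?FY"
    using assms by (auto intro!: measurable_compose[OF measurable_vimage_algebra1])
  have FX': "(\<lambda>\<omega>. u (X \<omega>)) -` A \<inter> space M \<in> sets ?FX"
    and FY': "(\<lambda>\<omega>. v (Y \<omega>)) -` A \<inter> space M \<in> sets ?FY" if "A \<in> sets borel" for A
    using measurable_sets[OF FX that] measurable_sets[OF FY that] by simp_all
  have sub: "sets ?FX \<subseteq> events" "sets ?FY \<subseteq> events"
    using ind by (auto simp: indep_sets2_eq)
  have "indep_var borel (\<lambda>\<omega>. u (X \<omega>)) borel (\<lambda>\<omega>. v (Y \<omega>))"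
    unfolding indep_var_eq
  proof (intro conjI)
    \<comment> \<open>Preimages under the composed functions already belong to the sigma-algebras
      generated by \<open>X\<close> and \<open>Y\<close>, and independence passes to
      subfamilies.\<close>
    have "sigma_sets (space M) {(\<lambda>\<omega>. u (X \<omega>)) -` A \<inter> space M |A. A \<in> sets borel} \<subseteq> sets ?FX"
      by (rule sets.sigma_sets_subset[of _ ?FX, simplified]) (use FX' in auto)
    moreover have "sigma_sets (space M) {(\<lambda>\<omega>. v (Y \<omega>)) -` A \<inter> space M |A. A \<in> sets borel} \<subseteq> sets ?FY"
      by (rule sets.sigma_sets_subset[of _ ?FY, simplified]) (use FY' in auto)
    ultimately show "indep_set (sigma_sets (space M) {(\<lambda>\<omega>. u (X \<omega>)) -` A \<inter> space M |A. A \<in> sets borel})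
      (sigma_sets (space M) {(\<lambda>\<omega>. v (Y \<omega>)) -` A \<inter> space M |A. A \<in> sets borel})"
      using ind unfolding indep_sets2_eq by blast
  qed (use FX' FY' sub in \<open>auto intro!: measurableI\<close>)
  moreover have "case_bool borel borel = (\<lambda>_. borel :: ennreal measure)"
    by (simp add: fun_eq_iff split: bool.split)
  ultimately have "indep_vars (\<lambda>_. borel) (case_bool (\<lambda>\<omega>. u (X \<omega>)) (\<lambda>\<omega>. v (Y \<omega>))) UNIV"
    unfolding indep_var_def by simp
  from indep_vars_nn_integral[OF _ this] show ?thesis
    by (simp add: UNIV_bool mult.commute)
qed

subsection \<open>Factorial moments of the model\<close>

definition linear_form :: "nat \<Rightarrow> nat \<Rightarrow> mparams \<Rightarrow> (nat \<Rightarrow> real) \<Rightarrow> (nat \<Rightarrow> real) \<Rightarrow> real" where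
  "linear_form p d \<theta> r w = (\<Sum>j<p. r j * (\<Sum>k<d. w k * reg_coef \<theta> $$ (j, k)))"

text \<open>The (j, l) entry of the conditional covariance \<Sigma> of the log rates given the
  covariates. It is a function of two indices, so that quadratic forms in \<Sigma> are plain double
  sums.\<close>

definition latent_cov :: "nat \<Rightarrow> nat \<Rightarrow> mparams \<Rightarrow> nat \<Rightarrow> nat \<Rightarrow> nat \<Rightarrow> real" where
  "latent_cov q m \<theta> s j l =
     (\<Sum>k<q. shared_load \<theta> $$ (j, k) * shared_load \<theta> $$ (l, k)) +
     (\<Sum>k<m. study_load \<theta> s $$ (j, k) * study_load \<theta> s $$ (l, k)) +
     (if j = l then noise_var \<theta> s else 0)"

section \<open>Linear and quadratic forms in the latent variables\<close>

lemma sum_square_linear: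
  fixes r :: "nat \<Rightarrow> real"
  shows "(\<Sum>k<m. (\<Sum>j<p. r j * c j k)\<^sup>2) = (\<Sum>j<p. \<Sum>l<p. r j * r l * (\<Sum>k<m. c j k * c l k))"
proof -
  have "(\<Sum>k<m. (\<Sum>j<p. r j * c j k)\<^sup>2) = (\<Sum>k<m. \<Sum>j<p. \<Sum>l<p. r j * r l * (c j k * c l k))"
    by (simp add: power2_eq_square sum_product mult_ac)
  also have "\<dots> = (\<Sum>j<p. \<Sum>k<m. \<Sum>l<p. r j * r l * (c j k * c l k))"
    by (rule sum.swap)
  also have "\<dots> = (\<Sum>j<p. \<Sum>l<p. \<Sum>k<m. r j * r l * (c j k * c l k))"
    by (intro sum.cong refl sum.swap)
  finally show ?thesis by (simp add: sum_distrib_left)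
qed

text \<open>The sum-of-squares shape is what the Gaussian moments produce, and it also shows that
  the form is at least the noise variance times the squared norm of r.\<close>

lemma latent_cov_form:
  fixes r :: "nat \<Rightarrow> real"
  shows "(\<Sum>j<p. \<Sum>l<p. r j * r l * latent_cov q m \<theta> s j l) =
    (\<Sum>k<q. (\<Sum>j<p. r j * shared_load \<theta> $$ (j, k))\<^sup>2) +
    (\<Sum>k<m. (\<Sum>j<p. r j * study_load \<theta> s $$ (j, k))\<^sup>2) +
    noise_var \<theta> s * (\<Sum>j<p. (r j)\<^sup>2)"
proof -
  have "(\<Sum>j<p. \<Sum>l<p. r j * r l * (if j = l then noise_var \<theta> s else 0)) = noise_var \<theta> s * (\<Sum>j<p. (r j)\<^sup>2)"
    by (simp add: sum.delta' if_distrib[where f="\<lambda>x. _ * x"] sum_distrib_left power2_eq_square mult_ac cong: if_cong)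
  then show ?thesis
    by (simp add: sum_square_linear latent_cov_def distrib_left sum.distrib)
qed

text \<open>Interchanging the sums separates the covariate part from the latent part, which are
  independent by (A1), and displays the coefficient of each latent coordinate.\<close>

lemma sum_log_rate:
  fixes r :: "nat \<Rightarrow> real"
  shows "(\<Sum>j<p. r j * log_rate p d q m \<theta> s zc fc hc ec j) = linear_form p d \<theta> r zc +
    ((\<Sum>k<q. fc k * (\<Sum>j<p. r j * shared_load \<theta> $$ (j, k))) +
     (\<Sum>k<m. hc k * (\<Sum>j<p. r j * study_load \<theta> s $$ (j, k))) + (\<Sum>j<p. ec j * r j))"
proof -
  have swap: "(\<Sum>k<m. g k * (\<Sum>j<p. r j * c j k)) = (\<Sum>j<p. r j * (\<Sum>k<m. g k * c j k))" for g c and m :: nat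
    by (simp add: sum_distrib_left mult_ac, rule sum.swap)
  show ?thesis
    unfolding swap linear_form_def
    by (simp add: log_rate_def distrib_left sum.distrib mult.commute[of "ec _"])
qed

section \<open>From the conditional Poisson law to exponential moments\<close>

context identifiability_conditions
begin

context
  fixes s i
  assumes s: "s \<in> {1..S}" and i: "i \<in> {1..n s}"
begin

abbreviation "rate_log \<omega> \<equiv> log_rate p d q (qs s) \<theta> s (z s i \<omega>) (f s i \<omega>) (h s i \<omega>) (e s i \<omega>)"

lemma shared_factor_rv [measurable]: "f s i \<in> M \<rightarrow>\<^sub>M real_vec_space q"
  and study_factor_rv [measurable]: "h s i \<in> M \<rightarrow>\<^sub>M real_vec_space (qs s)"
  and noise_rv [measurable]: "e s i \<in> M \<rightarrow>\<^sub>M real_vec_space p"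
proof -
  have "\<forall>t\<in>{..<3}. [f s i, h s i, e s i] ! t \<in> M \<rightarrow>\<^sub>M real_vec_space ([q, qs s, p] ! t)"
    using latent_indep[OF s i] unfolding indep_vars_def by blast
  from bspec[OF this, of 0] bspec[OF this, of 1] bspec[OF this, of 2]
  show "f s i \<in> M \<rightarrow>\<^sub>M real_vec_space q" "h s i \<in> M \<rightarrow>\<^sub>M real_vec_space (qs s)" "e s i \<in> M \<rightarrow>\<^sub>M real_vec_space p"
    by simp_all
qed

lemmas covariate_rv_si [measurable] = covariate_rv[OF s i]
lemmas count_rv_si [measurable] = count_rv[OF s i]

lemma rate_log_rv [measurable]: "(\<lambda>\<omega>. rate_log \<omega>) \<in> M \<rightarrow>\<^sub>M real_vec_space p"
proof -
  have comp: "(\<lambda>\<omega>. g \<omega> k) \<in> borel_measurable M" if "g \<in> M \<rightarrow>\<^sub>M real_vec_space m" "k < m" for g k m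
    using measurable_compose[OF that(1) measurable_component_singleton[of k "{..<m}"]] that(2) by simp
  show ?thesis
    unfolding log_rate_def
    by (intro measurable_restrict borel_measurable_add borel_measurable_sum borel_measurable_times
        borel_measurable_const comp[OF covariate_rv_si] comp[OF shared_factor_rv]
        comp[OF study_factor_rv] comp[OF noise_rv]) auto
qed

lemma rate_log_component [measurable]: "j < p \<Longrightarrow> (\<lambda>\<omega>. rate_log \<omega> j) \<in> borel_measurable M"
  using measurable_compose[OF rate_log_rv measurable_component_singleton[of j "{..<p}"]] by simp

lemma count_event: "{\<omega> \<in> space M. \<forall>j<p. x s i \<omega> j = c j} \<in> sets M"
proof -
  have "(\<lambda>\<omega>. x s i \<omega> j) \<in> M \<rightarrow>\<^sub>M count_space UNIV" if "j < p" for j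
    using measurable_compose[OF count_rv_si measurable_component_singleton[of j "{..<p}"]] that by simp
  then have "{\<omega> \<in> space M. x s i \<omega> j = c j} \<in> sets M" if "j < p" for j
    using that by measurable
  then have "{\<omega> \<in> space M. \<forall>j\<in>{..<p}. x s i \<omega> j = c j} \<in> sets M"
    by (intro sets.sets_Collect_finite_All) auto
  then show ?thesis by (simp add: lessThan_iff Ball_def)
qed

lemma poisson_prob_rv:
  "(\<lambda>\<omega>. \<Prod>j<p. pmf (poisson_pmf (a s i * exp (rate_log \<omega> j))) (c j)) \<in> borel_measurable M"
  using rate_log_component
  by (intro borel_measurable_prod) (simp add: pmf_poisson normalization[OF s i])

text \<open>The conditioning sigma-algebra is generated by the log rates together with the
  covariates, so it contains the event that z lies in B. Over that event the conditional probability
  may replace the indicator of the counts.\<close>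

lemma count_probability:
  assumes B: "B \<in> sets (real_vec_space d)"
  shows "(\<integral>\<^sup>+\<omega>. indicator {\<omega> \<in> space M. \<forall>j<p. x s i \<omega> j = c j} \<omega> * indicator B (z s i \<omega>) \<partial>M) =
    (\<integral>\<^sup>+\<omega>. ennreal (\<Prod>j<p. pmf (poisson_pmf (a s i * exp (rate_log \<omega> j))) (c j)) * indicator B (z s i \<omega>) \<partial>M)"
proof -
  let ?K = "real_vec_space p \<Otimes>\<^sub>M real_vec_space d"
  let ?F = "vimage_algebra (space M) (\<lambda>\<omega>. (rate_log \<omega>, z s i \<omega>)) ?K"
  let ?A = "{\<omega> \<in> space M. \<forall>j<p. x s i \<omega> j = c j}"
  let ?P = "\<lambda>\<omega>. \<Prod>j<p. pmf (poisson_pmf (a s i * exp (rate_log \<omega> j))) (c j)"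
  let ?IB = "\<lambda>\<omega>. indicator B (z s i \<omega>) :: real"
  have g: "(\<lambda>\<omega>. (rate_log \<omega>, z s i \<omega>)) \<in> M \<rightarrow>\<^sub>M ?K" by measurable
  then have sub: "subalgebra M ?F"
    unfolding subalgebra_def by (auto simp: sets_vimage_algebra2[OF measurable_space[OF g, THEN funcsetI]] intro: measurable_sets)
  interpret finite_measure_subalgebra M ?F by standard (rule sub)
  have A: "?A \<in> sets M" by (rule count_event)
  have IBF: "?IB \<in> borel_measurable ?F"
  proof -
    have "(\<lambda>w. indicator B (snd w) :: real) \<in> borel_measurable ?K" using B by measurable
    from measurable_compose[OF measurable_vimage_algebra1[OF measurable_space[OF g, THEN funcsetI]] this]
    show ?thesis by simp
  qed
  have IBM: "?IB \<in> borel_measurable M" using B by measurable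
  have AE_P: "AE \<omega> in M. real_cond_exp M ?F (indicator ?A) \<omega> = ?P \<omega>"
    using count_conditional_law[OF s i, of c] by (simp add: Let_def)
  have int: "integrable M (\<lambda>\<omega>. ?IB \<omega> * indicator ?A \<omega>)"
    using A IBM by (intro integrable_const_bound[where B=1]) (auto simp: indicator_def)
  have P0: "0 \<le> ?P \<omega>" for \<omega> by (intro prod_nonneg) simp
  have AE_IP: "AE \<omega> in M. ?IB \<omega> * real_cond_exp M ?F (indicator ?A) \<omega> = ?IB \<omega> * ?P \<omega>"
    using AE_P by eventually_elim simp
  have Pm: "?P \<in> borel_measurable M" by (rule poisson_prob_rv)
  have intR: "integrable M (\<lambda>\<omega>. ?IB \<omega> * ?P \<omega>)"
    using real_cond_exp_intg(1)[OF int IBF] A IBM Pm AE_IP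
    by (subst integrable_cong_AE[OF _ _ AE_symmetric[OF AE_IP]]) auto
  have "(\<integral>\<^sup>+\<omega>. indicator ?A \<omega> * indicator B (z s i \<omega>) \<partial>M) = (\<integral>\<^sup>+\<omega>. ennreal (?IB \<omega> * indicator ?A \<omega>) \<partial>M)"
    by (intro nn_integral_cong) (simp add: indicator_def)
  also have "\<dots> = ennreal (\<integral>\<omega>. ?IB \<omega> * indicator ?A \<omega> \<partial>M)"
    using int by (intro nn_integral_eq_integral) auto
  also have "(\<integral>\<omega>. ?IB \<omega> * indicator ?A \<omega> \<partial>M) = (\<integral>\<omega>. ?IB \<omega> * real_cond_exp M ?F (indicator ?A) \<omega> \<partial>M)"
    using real_cond_exp_intg(2)[OF int IBF] A by simp
  also have "\<dots> = (\<integral>\<omega>. ?IB \<omega> * ?P \<omega> \<partial>M)"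
    using AE_IP IBM Pm by (intro integral_cong_AE) auto
  also have "ennreal \<dots> = (\<integral>\<^sup>+\<omega>. ennreal (?IB \<omega> * ?P \<omega>) \<partial>M)"
    using intR P0 by (intro nn_integral_eq_integral[symmetric]) auto
  also have "\<dots> = (\<integral>\<^sup>+\<omega>. ennreal (?P \<omega>) * indicator B (z s i \<omega>) \<partial>M)"
    by (intro nn_integral_cong) (simp add: indicator_def)
  finally show ?thesis .
qed

text \<open>The expectation is expanded as a sum over the countably many count vectors c. Tonelli
  allows each event to be replaced by its Poisson product, and the sum over c then factors into
  one-dimensional factorial moments.\<close>

lemma count_factorial_moment:
  assumes B: "B \<in> sets (real_vec_space d)"
  shows "(\<integral>\<^sup>+\<omega>. ennreal (\<Prod>j<p. ffact (r j) (x s i \<omega> j)) * indicator B (z s i \<omega>) \<partial>M) =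
    (\<integral>\<^sup>+\<omega>. ennreal (\<Prod>j<p. (a s i * exp (rate_log \<omega> j)) ^ r j) * indicator B (z s i \<omega>) \<partial>M)"
proof -
  let ?X = "PiE {..<p} (\<lambda>_. UNIV :: nat set)"
  let ?C = "count_space ?X"
  let ?\<phi> = "\<lambda>c. \<Prod>j<p. ffact (r j) (c j)"
  let ?A = "\<lambda>c. {\<omega> \<in> space M. \<forall>j<p. x s i \<omega> j = c j}"
  let ?P = "\<lambda>\<omega> c. \<Prod>j<p. pmf (poisson_pmf (a s i * exp (rate_log \<omega> j))) (c j)"
  \<comment> \<open>A finite product of counting measures is the counting measure on tuples; by
    \<open>countX\<close> it is sigma-finite.\<close>
  have C: "count_vec_space p = ?C" by (intro count_space_PiM_finite) auto
  have countX: "countable ?X" by (intro countable_PiE) auto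
  interpret C: sigma_finite_measure ?C
    by (rule sigma_finite_measure_count_space_countable[OF countX])
  interpret CM: pair_sigma_finite ?C M ..
  interpret nat: sigma_finite_measure "count_space (UNIV :: nat set)"
    by (rule sigma_finite_measure_count_space_countable) simp
  interpret PC: product_sigma_finite "\<lambda>_ :: nat. count_space (UNIV :: nat set)" ..
  have \<phi>0: "0 \<le> ?\<phi> c" for c by (intro prod_nonneg) simp
  have P0: "0 \<le> ?P \<omega> c" for \<omega> c by (intro prod_nonneg) simp
  have rate_pos: "0 < a s i * exp t" for t using normalization[OF s i] by simp
  have Pm: "(\<lambda>\<omega>. ?P \<omega> c) \<in> borel_measurable M" for c by (rule poisson_prob_rv)
  have Am: "?A c \<in> sets M" for c by (rule count_event)
  have IBm: "(\<lambda>\<omega>. indicator B (z s i \<omega>) :: ennreal) \<in> borel_measurable M" using B by measurable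
  have xX: "x s i \<omega> \<in> ?X" if "\<omega> \<in> space M" for \<omega>
    using measurable_space[OF count_rv[OF s i] that] by (simp add: space_PiM)
  \<comment> \<open>Members of \<open>?X\<close> are determined by their first p coordinates, so
    agreement there is equality and only c = x contributes to the sum.\<close>
  have eqA: "indicator (?A c) \<omega> = (indicator {x s i \<omega>} c :: ennreal)" if "\<omega> \<in> space M" "c \<in> ?X" for \<omega> c
  proof -
    have "(\<forall>j<p. x s i \<omega> j = c j) \<longleftrightarrow> c = x s i \<omega>"
      using PiE_ext[OF that(2) xX[OF that(1)]] by auto
    then show ?thesis using that(1) by (simp add: indicator_def)
  qed
  have "(\<integral>\<^sup>+\<omega>. ennreal (?\<phi> (x s i \<omega>)) * indicator B (z s i \<omega>) \<partial>M) =
    (\<integral>\<^sup>+\<omega>. \<integral>\<^sup>+c. ennreal (?\<phi> c) * (indicator (?A c) \<omega> * indicator B (z s i \<omega>)) \<partial>?C \<partial>M)"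
  proof (rule nn_integral_cong)
    fix \<omega> assume \<omega>: "\<omega> \<in> space M"
    have "(\<integral>\<^sup>+c. ennreal (?\<phi> c) * (indicator (?A c) \<omega> * indicator B (z s i \<omega>)) \<partial>?C) =
      (\<integral>\<^sup>+c. (ennreal (?\<phi> c) * indicator B (z s i \<omega>)) * indicator {x s i \<omega>} c \<partial>?C)"
      using eqA[OF \<omega>] by (intro nn_integral_cong) (simp add: mult_ac)
    also have "\<dots> = ennreal (?\<phi> (x s i \<omega>)) * indicator B (z s i \<omega>)"
      using xX[OF \<omega>] by (subst nn_integral_indicator_singleton) auto
    finally show "ennreal (?\<phi> (x s i \<omega>)) * indicator B (z s i \<omega>) =
      (\<integral>\<^sup>+c. ennreal (?\<phi> c) * (indicator (?A c) \<omega> * indicator B (z s i \<omega>)) \<partial>?C)" by simp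
  qed
  also have "\<dots> = (\<integral>\<^sup>+c. \<integral>\<^sup>+\<omega>. ennreal (?\<phi> c) * (indicator (?A c) \<omega> * indicator B (z s i \<omega>)) \<partial>M \<partial>?C)"
    using Am IBm
    by (intro CM.Fubini'[of "\<lambda>c \<omega>. ennreal (?\<phi> c) * (indicator (?A c) \<omega> * indicator B (z s i \<omega>))"]
        measurable_pair_measure_countable1[OF countX]) auto
  also have "\<dots> = (\<integral>\<^sup>+c. \<integral>\<^sup>+\<omega>. ennreal (?\<phi> c) * (ennreal (?P \<omega> c) * indicator B (z s i \<omega>)) \<partial>M \<partial>?C)"
  proof (rule nn_integral_cong)
    fix c
    show "(\<integral>\<^sup>+\<omega>. ennreal (?\<phi> c) * (indicator (?A c) \<omega> * indicator B (z s i \<omega>)) \<partial>M) =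
      (\<integral>\<^sup>+\<omega>. ennreal (?\<phi> c) * (ennreal (?P \<omega> c) * indicator B (z s i \<omega>)) \<partial>M)"
      using Am IBm Pm by (subst (1 2) nn_integral_cmult) (simp_all add: count_probability[OF B])
  qed
  also have "\<dots> = (\<integral>\<^sup>+\<omega>. \<integral>\<^sup>+c. ennreal (?\<phi> c) * (ennreal (?P \<omega> c) * indicator B (z s i \<omega>)) \<partial>?C \<partial>M)"
    using Pm IBm
    by (intro CM.Fubini'[of "\<lambda>c \<omega>. ennreal (?\<phi> c) * (ennreal (?P \<omega> c) * indicator B (z s i \<omega>))", symmetric]
        measurable_pair_measure_countable1[OF countX]) auto
  also have "\<dots> = (\<integral>\<^sup>+\<omega>. ennreal (\<Prod>j<p. (a s i * exp (rate_log \<omega> j)) ^ r j) * indicator B (z s i \<omega>) \<partial>M)"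
  proof (rule nn_integral_cong)
    fix \<omega>
    have "(\<integral>\<^sup>+c. ennreal (?\<phi> c) * (ennreal (?P \<omega> c) * indicator B (z s i \<omega>)) \<partial>?C) =
      (\<integral>\<^sup>+c. (\<Prod>j<p. ennreal (ffact (r j) (c j) * pmf (poisson_pmf (a s i * exp (rate_log \<omega> j))) (c j))) *
        indicator B (z s i \<omega>) \<partial>?C)"
      using \<phi>0 P0 by (intro nn_integral_cong)
        (simp add: prod_ennreal ennreal_mult[symmetric] prod.distrib mult.assoc[symmetric])
    also have "\<dots> = (\<integral>\<^sup>+c. (\<Prod>j<p. ennreal (ffact (r j) (c j) * pmf (poisson_pmf (a s i * exp (rate_log \<omega> j))) (c j))) \<partial>?C) *
        indicator B (z s i \<omega>)"
      by (rule nn_integral_multc) simp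
    also have "(\<integral>\<^sup>+c. (\<Prod>j<p. ennreal (ffact (r j) (c j) * pmf (poisson_pmf (a s i * exp (rate_log \<omega> j))) (c j))) \<partial>?C) =
      (\<Prod>j<p. ennreal ((a s i * exp (rate_log \<omega> j)) ^ r j))"
      unfolding C[symmetric]
      by (subst PC.product_nn_integral_prod) (simp_all only: poisson_factorial_moment[OF rate_pos] finite_lessThan measurable_count_space space_borel measurable_count_space_eq1 UNIV_I Pi_UNIV)
    also have "\<dots> = ennreal (\<Prod>j<p. (a s i * exp (rate_log \<omega> j)) ^ r j)"
      using rate_pos by (intro prod_ennreal) (simp add: less_imp_le)
    finally show "(\<integral>\<^sup>+c. ennreal (?\<phi> c) * (ennreal (?P \<omega> c) * indicator B (z s i \<omega>)) \<partial>?C) =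
      ennreal (\<Prod>j<p. (a s i * exp (rate_log \<omega> j)) ^ r j) * indicator B (z s i \<omega>)" .
  qed
  finally show ?thesis .
qed

text \<open>The three latent vectors are independent, so the expectation is a product of three
  Gaussian exponential moments, with variances 1, 1 and \<open>noise_var \<theta> s\<close>.\<close>

lemma latent_exponential_moment:
  "(\<integral>\<^sup>+\<omega>. ennreal (exp ((\<Sum>k<q. f s i \<omega> k * u k) + (\<Sum>k<qs s. h s i \<omega> k * v k) + (\<Sum>j<p. e s i \<omega> j * w j))) \<partial>M) =
    ennreal (exp (((\<Sum>k<q. (u k)\<^sup>2) + (\<Sum>k<qs s. (v k)\<^sup>2) + noise_var \<theta> s * (\<Sum>j<p. (w j)\<^sup>2)) / 2))"
proof -
  let ?E = "\<lambda>m u t. ennreal (exp (\<Sum>k<m. t k * u k))"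
  have Em: "?E m u \<in> borel_measurable (real_vec_space m)" for m and u :: "nat \<Rightarrow> real"
    by measurable
  have law: "(\<integral>\<^sup>+\<omega>. ?E m c (g \<omega>) \<partial>M) = ennreal (exp (l * (\<Sum>k<m. (c k)\<^sup>2) / 2))"
    if g: "g \<in> M \<rightarrow>\<^sub>M real_vec_space m" and g_law: "distr M (real_vec_space m) g = normal_vec m l" and "0 < l"
    for m l g and c :: "nat \<Rightarrow> real"
  proof -
    have "(\<integral>\<^sup>+\<omega>. ?E m c (g \<omega>) \<partial>M) = (\<integral>\<^sup>+t. ?E m c t \<partial>distr M (real_vec_space m) g)"
      by (rule nn_integral_distr[OF g, symmetric]) measurable
    then show ?thesis unfolding g_law using normal_vec_exponential_moment[OF \<open>0 < l\<close>, of m c] by simp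
  qed
  have "indep_vars (\<lambda>_. borel) (\<lambda>t \<omega>. ([?E q u, ?E (qs s) v, ?E p w] ! t) (([f s i, h s i, e s i] ! t) \<omega>)) {..<3}"
    using Em by (intro indep_vars_compose2[OF latent_indep[OF s i]]) (auto simp: less_Suc_eq numeral_3_eq_3)
  from indep_vars_nn_integral[OF _ this]
  have "(\<integral>\<^sup>+\<omega>. ?E q u (f s i \<omega>) * ?E (qs s) v (h s i \<omega>) * ?E p w (e s i \<omega>) \<partial>M) =
    (\<integral>\<^sup>+\<omega>. ?E q u (f s i \<omega>) \<partial>M) * (\<integral>\<^sup>+\<omega>. ?E (qs s) v (h s i \<omega>) \<partial>M) * (\<integral>\<^sup>+\<omega>. ?E p w (e s i \<omega>) \<partial>M)"
    by (simp add: numeral_3_eq_3)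
  also have "(\<integral>\<^sup>+\<omega>. ?E q u (f s i \<omega>) \<partial>M) = ennreal (exp (1 * (\<Sum>k<q. (u k)\<^sup>2) / 2))"
    by (rule law[OF shared_factor_rv shared_factor_law[OF s i]]) simp
  also have "(\<integral>\<^sup>+\<omega>. ?E (qs s) v (h s i \<omega>) \<partial>M) = ennreal (exp (1 * (\<Sum>k<qs s. (v k)\<^sup>2) / 2))"
    by (rule law[OF study_factor_rv study_factor_law[OF s i]]) simp
  also have "(\<integral>\<^sup>+\<omega>. ?E p w (e s i \<omega>) \<partial>M) = ennreal (exp (noise_var \<theta> s * (\<Sum>j<p. (w j)\<^sup>2) / 2))"
    by (rule law[OF noise_rv noise_law[OF s i] noise_var_pos[OF s]])
  finally show ?thesis
    by (simp add: ennreal_mult[symmetric] exp_add[symmetric] add_divide_distrib)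
qed

text \<open>The product of powers of the rates is a power of \<open>a s i\<close> times exp(r^T y).
  The right side is an integral over an arbitrary set B under the covariate law, so that two models
  can be compared by uniqueness of densities.\<close>

lemma count_factorial_moment_eq:
  assumes B: "B \<in> sets (real_vec_space d)"
  shows "(\<integral>\<^sup>+\<omega>. ennreal (\<Prod>j<p. ffact (r j) (x s i \<omega> j)) * indicator B (z s i \<omega>) \<partial>M) =
    (\<integral>\<^sup>+w. ennreal (a s i ^ (\<Sum>j<p. r j) * exp (linear_form p d \<theta> (\<lambda>j. real (r j)) w +
       (\<Sum>j<p. \<Sum>l<p. real (r j) * real (r l) * latent_cov q (qs s) \<theta> s j l) / 2)) * indicator B w
     \<partial>distr M (real_vec_space d) (z s i))"
proof -
  let ?r = "\<lambda>j. real (r j)"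
  let ?u = "\<lambda>k. \<Sum>j<p. ?r j * shared_load \<theta> $$ (j, k)"
  let ?v = "\<lambda>k. \<Sum>j<p. ?r j * study_load \<theta> s $$ (j, k)"
  let ?V = "\<Sum>j<p. \<Sum>l<p. ?r j * ?r l * latent_cov q (qs s) \<theta> s j l"
  let ?Z = "\<lambda>w. ennreal (a s i ^ (\<Sum>j<p. r j) * exp (linear_form p d \<theta> ?r w)) * indicator B w"
  let ?L = "\<lambda>(ff, hh, ee). ennreal (exp ((\<Sum>k<q. ff k * ?u k) + (\<Sum>k<qs s. hh k * ?v k) + (\<Sum>j<p. ee j * ?r j)))"
  have a: "0 < a s i" by (rule normalization[OF s i])
  have Zm: "?Z \<in> borel_measurable (real_vec_space d)"
    unfolding linear_form_def using B by measurable
  have Lm: "?L \<in> borel_measurable (real_vec_space q \<Otimes>\<^sub>M real_vec_space (qs s) \<Otimes>\<^sub>M real_vec_space p)"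
    by measurable
  have fhe: "(\<lambda>\<omega>. (f s i \<omega>, h s i \<omega>, e s i \<omega>)) \<in> M \<rightarrow>\<^sub>M real_vec_space q \<Otimes>\<^sub>M real_vec_space (qs s) \<Otimes>\<^sub>M real_vec_space p"
    by measurable
  have "(\<Prod>j<p. (a s i * exp (rate_log \<omega> j)) ^ r j) =
      a s i ^ (\<Sum>j<p. r j) * exp (\<Sum>j<p. ?r j * rate_log \<omega> j)" for \<omega>
    by (simp add: power_mult_distrib prod.distrib power_sum exp_sum exp_of_nat_mult)
  then have "(\<integral>\<^sup>+\<omega>. ennreal (\<Prod>j<p. ffact (r j) (x s i \<omega> j)) * indicator B (z s i \<omega>) \<partial>M) =
    (\<integral>\<^sup>+\<omega>. ?Z (z s i \<omega>) * ?L (f s i \<omega>, h s i \<omega>, e s i \<omega>) \<partial>M)"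
    unfolding count_factorial_moment[OF B] using a
    by (intro nn_integral_cong) (simp add: sum_log_rate exp_add ennreal_mult mult_ac)
  \<comment> \<open>By (A1) the covariate factor and the latent factor integrate separately.\<close>
  also have "\<dots> = (\<integral>\<^sup>+\<omega>. ?Z (z s i \<omega>) \<partial>M) * (\<integral>\<^sup>+\<omega>. ?L (f s i \<omega>, h s i \<omega>, e s i \<omega>) \<partial>M)"
    by (rule nn_integral_mult_indep_vimage[OF A1_indep[OF s i] _ _ Zm Lm])
      (use measurable_space[OF covariate_rv[OF s i]] measurable_space[OF fhe] in auto)
  also have "(\<integral>\<^sup>+\<omega>. ?L (f s i \<omega>, h s i \<omega>, e s i \<omega>) \<partial>M) = ennreal (exp (?V / 2))"
    unfolding prod.case latent_exponential_moment latent_cov_form ..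
  also have "(\<integral>\<^sup>+\<omega>. ?Z (z s i \<omega>) \<partial>M) = (\<integral>\<^sup>+w. ?Z w \<partial>distr M (real_vec_space d) (z s i))"
    using Zm by (simp add: nn_integral_distr[OF covariate_rv[OF s i]])
  also have "\<dots> * ennreal (exp (?V / 2)) = (\<integral>\<^sup>+w. ?Z w * ennreal (exp (?V / 2)) \<partial>distr M (real_vec_space d) (z s i))"
    using Zm by (intro nn_integral_multc[symmetric]) simp
  also have "\<dots> = (\<integral>\<^sup>+w. ennreal (a s i ^ (\<Sum>j<p. r j) * exp (linear_form p d \<theta> ?r w + ?V / 2)) * indicator B w
     \<partial>distr M (real_vec_space d) (z s i))"
    using a by (intro nn_integral_cong) (simp add: exp_add ennreal_mult mult_ac)
  finally show ?thesis .
qed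

end

text \<open>The second moment of c^T z is c^T E(z z^T) c. It vanishes under the hypothesis, whereas
  positive definiteness makes it positive for nonzero c.\<close>

lemma covariate_form_zero:
  assumes s: "s \<in> {1..S}" and i: "i \<in> {1..n s}"
    and AE: "AE \<omega> in M. (\<Sum>k<d. z s i \<omega> k * c k) = 0" and "k < d"
  shows "c k = 0"
proof (rule ccontr)
  assume "c k \<noteq> 0"
  let ?W = "mat d d (\<lambda>(k, l). expectation (\<lambda>\<omega>. z s i \<omega> k * z s i \<omega> l))"
  have "vec d c \<noteq> 0\<^sub>v d"
  proof
    assume "vec d c = 0\<^sub>v d"
    then have "vec d c $ k = 0\<^sub>v d $ k" by (rule arg_cong)
    with \<open>k < d\<close> \<open>c k \<noteq> 0\<close> show False by simp
  qed
  moreover have "0 < scalar_prod v (?W *\<^sub>v v)" if "v \<in> carrier_vec d" "v \<noteq> 0\<^sub>v d" for v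
    using A1_pos_def[OF s i] that unfolding pos_def_mat_def dim_row_mat by blast
  ultimately have "0 < scalar_prod (vec d c) (?W *\<^sub>v vec d c)" by simp
  also have "scalar_prod (vec d c) (?W *\<^sub>v vec d c) =
      (\<Sum>k<d. \<Sum>l<d. c k * c l * expectation (\<lambda>\<omega>. z s i \<omega> k * z s i \<omega> l))"
    by (simp add: scalar_prod_def lessThan_atLeast0 sum_distrib_left mult_ac)
  also have "\<dots> = expectation (\<lambda>\<omega>. \<Sum>k<d. \<Sum>l<d. c k * c l * (z s i \<omega> k * z s i \<omega> l))"
  proof -
    have int: "integrable M (\<lambda>\<omega>. c k * c l * (z s i \<omega> k * z s i \<omega> l))" if "k \<in> {..<d}" "l \<in> {..<d}" for k l
      using A1_second_moments[OF s i, of k l] that by (intro integrable_mult_right) simp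
    have "expectation (\<lambda>\<omega>. \<Sum>k<d. \<Sum>l<d. c k * c l * (z s i \<omega> k * z s i \<omega> l)) =
        (\<Sum>k<d. expectation (\<lambda>\<omega>. \<Sum>l<d. c k * c l * (z s i \<omega> k * z s i \<omega> l)))"
      by (intro Bochner_Integration.integral_sum Bochner_Integration.integrable_sum int)
    also have "\<dots> = (\<Sum>k<d. \<Sum>l<d. expectation (\<lambda>\<omega>. c k * c l * (z s i \<omega> k * z s i \<omega> l)))"
      by (intro sum.cong refl Bochner_Integration.integral_sum int)
    finally show ?thesis by simp
  qed
  \<comment> \<open>The double sum is the square of the linear form, hence zero almost
    everywhere.\<close>
  also have "\<dots> = expectation (\<lambda>\<omega>. 0)"
  proof (rule integral_cong_AE)
    have zk: "(\<lambda>\<omega>. z s i \<omega> k) \<in> borel_measurable M" if "k < d" for k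
      using measurable_compose[OF covariate_rv[OF s i] measurable_component_singleton[of k "{..<d}"]] that by simp
    show "(\<lambda>\<omega>. \<Sum>k<d. \<Sum>l<d. c k * c l * (z s i \<omega> k * z s i \<omega> l)) \<in> borel_measurable M"
      using zk by (intro borel_measurable_sum borel_measurable_times borel_measurable_const) auto
    show "AE \<omega> in M. (\<Sum>k<d. \<Sum>l<d. c k * c l * (z s i \<omega> k * z s i \<omega> l)) = 0"
      using AE
    proof eventually_elim
      case (elim \<omega>)
      have "(\<Sum>k<d. \<Sum>l<d. c k * c l * (z s i \<omega> k * z s i \<omega> l)) = (\<Sum>k<d. z s i \<omega> k * c k) * (\<Sum>l<d. z s i \<omega> l * c l)"
        by (simp add: sum_product mult_ac)
      then show ?case using elim by simp
    qed
  qed simp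
  finally show False by simp
qed

end

subsection \<open>Identification of the parameters\<close>

text \<open>Only test vectors c e_j + c' e_l with natural coefficients occur, since they must be
  orders of factorial moments; for j = l the two contributions add up. Finitely many of them
  determine the coefficients.\<close>

lemma quadratic_polynomial_zero:
  fixes \<delta> :: "nat \<Rightarrow> real" and D :: "nat \<Rightarrow> nat \<Rightarrow> real"
  defines "r \<equiv> \<lambda>c c' j l t. real ((if t = j then c else 0) + (if t = l then c' else 0))"
  assumes eq: "\<And>c c' j l. j < p \<Longrightarrow> l < p \<Longrightarrow>
      (\<Sum>t<p. r c c' j l t * \<delta> t) + (\<Sum>t<p. \<Sum>u<p. r c c' j l t * r c c' j l u * D t u) / 2 = 0"
    and sym: "\<And>j l. D j l = D l j" and "j < p" "l < p"
  shows "\<delta> j = 0" "D j l = 0"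
proof -
  have sum_r: "(\<Sum>t<p. r c c' j l t * g t) = real c * g j + real c' * g l" if "j < p" "l < p" for c c' j l g
  proof -
    have "(\<Sum>t<p. r c c' j l t * g t) = (\<Sum>t<p. (if t = j then real c * g j else 0) + (if t = l then real c' * g l else 0))"
      by (intro sum.cong) (auto simp: r_def algebra_simps)
    then show ?thesis using that by (simp add: sum.distrib)
  qed
  have E: "real c * \<delta> j + real c' * \<delta> l +
    (real c * (real c * D j j + real c' * D j l) + real c' * (real c * D l j + real c' * D l l)) / 2 = 0"
    if "j < p" "l < p" for c c' j l
    using eq[OF that, of c c'] that by (simp add: mult.assoc sum_distrib_left[symmetric] sum_r)
  \<comment> \<open>Orders e_j and 2 e_j give \<delta>_j + D_jj / 2 = 0 and 2 \<delta>_j + 2 D_jj =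
    0, which separate the linear from the quadratic coefficient.\<close>
  have diag: "\<delta> j = 0 \<and> D j j = 0" if "j < p" for j
    using E[OF that that, of 1 0] E[OF that that, of 2 0] by simp
  show "\<delta> j = 0" using diag[OF \<open>j < p\<close>] ..
  show "D j l = 0"
    using E[OF \<open>j < p\<close> \<open>l < p\<close>, of 1 1] diag[OF \<open>j < p\<close>] diag[OF \<open>l < p\<close>] sym[of j l] by simp
qed

text \<open>Equal joint laws give equal factorial moments over every covariate set. Hence the
  exponents agree for almost every covariate value, and comparing them as polynomials in r separates
  \<beta> from \<Sigma>.\<close>

lemma same_law_imp_same_mean_cov:
  assumes "identifiability_conditions M S n p d q qs a \<theta> z f h e x"
    and "identifiability_conditions M' S n p d q qs a \<theta>' z' f' h' e' x'"
    and s: "s \<in> {1..S}" and i: "i \<in> {1..n s}"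
    and z_law: "distr M (real_vec_space d) (z s i) = distr M' (real_vec_space d) (z' s i)"
    and xz_law: "distr M (count_vec_space p \<Otimes>\<^sub>M real_vec_space d) (\<lambda>\<omega>. (x s i \<omega>, z s i \<omega>)) =
      distr M' (count_vec_space p \<Otimes>\<^sub>M real_vec_space d) (\<lambda>\<omega>. (x' s i \<omega>, z' s i \<omega>))"
    and "j < p"
  shows "k < d \<Longrightarrow> reg_coef \<theta> $$ (j, k) = reg_coef \<theta>' $$ (j, k)"
    and "l < p \<Longrightarrow> latent_cov q (qs s) \<theta> s j l = latent_cov q (qs s) \<theta>' s j l"
proof -
  interpret A: identifiability_conditions M S n p d q qs a \<theta> z f h e x by fact
  interpret B: identifiability_conditions M' S n p d q qs a \<theta>' z' f' h' e' x' by fact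
  \<comment> \<open>By \<open>z_law\<close> this one measure serves both models, and the moments
    become two densities with respect to it.\<close>
  let ?\<mu> = "distr M (real_vec_space d) (z s i)"
  interpret \<mu>: prob_space ?\<mu> by (rule A.prob_space_distr[OF A.covariate_rv[OF s i]])
  let ?V = "\<lambda>\<theta> r. \<Sum>j<p. \<Sum>l<p. real (r j) * real (r l) * latent_cov q (qs s) \<theta> s j l"
  let ?F = "\<lambda>\<theta> (r :: nat \<Rightarrow> nat) w. a s i ^ (\<Sum>j<p. r j) * exp (linear_form p d \<theta> (\<lambda>j. real (r j)) w + ?V \<theta> r / 2)"
  have a: "0 < a s i" by (rule A.normalization[OF s i])
  have law_eq: "AE w in ?\<mu>. linear_form p d \<theta> (\<lambda>j. real (r j)) w + ?V \<theta> r / 2 =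
      linear_form p d \<theta>' (\<lambda>j. real (r j)) w + ?V \<theta>' r / 2" for r
  proof -
    have Fm: "(\<lambda>w. ennreal (?F t r w)) \<in> borel_measurable ?\<mu>" for t
      unfolding linear_form_def by measurable
    have "AE w in ?\<mu>. ennreal (?F \<theta> r w) = ennreal (?F \<theta>' r w)"
    proof (rule \<mu>.density_unique2[OF Fm Fm])
      fix C assume "C \<in> sets ?\<mu>"
      then have C: "C \<in> sets (real_vec_space d)" by simp
      let ?g = "\<lambda>c. ennreal (\<Prod>j<p. ffact (r j) (c j))"
      have "?g \<in> borel_measurable (count_vec_space p)"
        by (subst count_space_PiM_finite) auto
      then have gm: "(\<lambda>y. ?g (fst y) * indicator C (snd y)) \<in> borel_measurable (count_vec_space p \<Otimes>\<^sub>M real_vec_space d)"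
        using C by measurable
      have xz: "(\<lambda>\<omega>. (x s i \<omega>, z s i \<omega>)) \<in> M \<rightarrow>\<^sub>M count_vec_space p \<Otimes>\<^sub>M real_vec_space d"
        "(\<lambda>\<omega>. (x' s i \<omega>, z' s i \<omega>)) \<in> M' \<rightarrow>\<^sub>M count_vec_space p \<Otimes>\<^sub>M real_vec_space d"
        by (intro measurable_Pair A.count_rv A.covariate_rv B.count_rv B.covariate_rv s i)+
      have "(\<integral>\<^sup>+w\<in>C. ennreal (?F \<theta> r w) \<partial>?\<mu>) = (\<integral>\<^sup>+\<omega>. ?g (x s i \<omega>) * indicator C (z s i \<omega>) \<partial>M)"
        by (rule A.count_factorial_moment_eq[OF s i C, symmetric])
      also have "\<dots> = (\<integral>\<^sup>+y. ?g (fst y) * indicator C (snd y) \<partial>distr M (count_vec_space p \<Otimes>\<^sub>M real_vec_space d) (\<lambda>\<omega>. (x s i \<omega>, z s i \<omega>)))"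
        using gm by (simp add: nn_integral_distr[OF xz(1)])
      also have "\<dots> = (\<integral>\<^sup>+\<omega>. ?g (x' s i \<omega>) * indicator C (z' s i \<omega>) \<partial>M')"
        unfolding xz_law using gm by (simp add: nn_integral_distr[OF xz(2)])
      also have "\<dots> = (\<integral>\<^sup>+w\<in>C. ennreal (?F \<theta>' r w) \<partial>?\<mu>)"
        unfolding z_law by (rule B.count_factorial_moment_eq[OF s i C])
      finally show "(\<integral>\<^sup>+w\<in>C. ennreal (?F \<theta> r w) \<partial>?\<mu>) = (\<integral>\<^sup>+w\<in>C. ennreal (?F \<theta>' r w) \<partial>?\<mu>)" .
    qed
    then show ?thesis
      \<comment> \<open>The common positive power of \<open>a s i\<close> cancels, and the
        exponential is injective.\<close>
      by eventually_elim (use a in \<open>simp add: ennreal_inj\<close>)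
  qed
  define \<delta> where "\<delta> w j = (\<Sum>k<d. w k * (reg_coef \<theta> $$ (j, k) - reg_coef \<theta>' $$ (j, k)))" for w :: "nat \<Rightarrow> real" and j
  define D where "D j l = latent_cov q (qs s) \<theta> s j l - latent_cov q (qs s) \<theta>' s j l" for j l
  have poly: "AE w in ?\<mu>. (\<Sum>t<p. real (r t) * \<delta> w t) + (\<Sum>t<p. \<Sum>u<p. real (r t) * real (r u) * D t u) / 2 = 0" for r
    using law_eq[of r]
  proof eventually_elim
    case (elim w)
    have "(\<Sum>t<p. real (r t) * \<delta> w t) = linear_form p d \<theta> (\<lambda>j. real (r j)) w - linear_form p d \<theta>' (\<lambda>j. real (r j)) w"
      by (simp add: \<delta>_def linear_form_def right_diff_distrib sum_subtractf)
    moreover have "(\<Sum>t<p. \<Sum>u<p. real (r t) * real (r u) * D t u) = ?V \<theta> r - ?V \<theta>' r"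
      by (simp add: D_def right_diff_distrib sum_subtractf)
    ultimately show ?case using elim by (simp add: diff_divide_distrib)
  qed
  \<comment> \<open>The quantified variables are natural numbers, so countably many null sets are
    merged and one w serves all test vectors.\<close>
  have "AE w in ?\<mu>. \<forall>c c' j l. let r = \<lambda>t. real ((if t = j then c else 0) + (if t = l then c' else 0)) in
      (\<Sum>t<p. r t * \<delta> w t) + (\<Sum>t<p. \<Sum>u<p. r t * r u * D t u) / 2 = 0"
    unfolding Let_def AE_all_countable by (intro allI poly)
  then have zero: "AE w in ?\<mu>. \<delta> w j = 0 \<and> (\<forall>l<p. D j l = 0)"
  proof eventually_elim
    case (elim w)
    have sym: "D j l = D l j" for j l by (simp add: D_def latent_cov_def mult.commute)
    show ?case
      using quadratic_polynomial_zero[of p "\<delta> w" D j] elim sym \<open>j < p\<close> unfolding Let_def by blast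
  qed
  then have "AE \<omega> in M. \<delta> (z s i \<omega>) j = 0"
    by (intro AE_distrD[OF A.covariate_rv[OF s i]]) auto
  then show "reg_coef \<theta> $$ (j, k) = reg_coef \<theta>' $$ (j, k)" if "k < d"
    using A.covariate_form_zero[OF s i _ that, of "\<lambda>k. reg_coef \<theta> $$ (j, k) - reg_coef \<theta>' $$ (j, k)"]
    by (simp add: \<delta>_def)
  have "AE w in ?\<mu>. \<forall>l<p. D j l = 0" using zero by eventually_elim simp
  \<comment> \<open>\<open>D\<close> does not depend on w, so under a probability measure the almost
    sure statement holds outright.\<close>
  then have "\<forall>l<p. D j l = 0" by (simp add: \<mu>.AE_const)
  then show "latent_cov q (qs s) \<theta> s j l = latent_cov q (qs s) \<theta>' s j l" if "l < p"
    using that by (simp add: D_def)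
qed

lemma sum_lessThan_add:
  fixes g :: "nat \<Rightarrow> 'a::comm_monoid_add"
  shows "(\<Sum>k<q + m. g k) = (\<Sum>k<q. g k) + (\<Sum>k<m. g (q + k))"
  by (induction m) (simp_all add: add.assoc)

text \<open>The low-rank part of the latent covariance has a nonzero kernel vector, on which the
  covariance form sees the noise variance alone.\<close>

lemma noise_var_le:
  assumes "q + m < p"
    and cov: "\<And>j l. j < p \<Longrightarrow> l < p \<Longrightarrow> latent_cov q m \<theta> s j l = latent_cov q m \<theta>' s j l"
  shows "noise_var \<theta>' s \<le> noise_var \<theta> s"
proof -
  \<comment> \<open>The two loading matrices of \<theta> are placed side by side, with q + m columns
    in total, fewer than the p rows.\<close>
  obtain r :: "nat \<Rightarrow> real" where r: "\<exists>j<p. r j \<noteq> 0"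
    and ker: "\<And>k. k < q + m \<Longrightarrow>
      (\<Sum>j<p. r j * (if k < q then shared_load \<theta> $$ (j, k) else study_load \<theta> s $$ (j, k - q))) = 0"
    using wide_matrix_kernel[OF assms(1), of "\<lambda>j k. if k < q then shared_load \<theta> $$ (j, k) else study_load \<theta> s $$ (j, k - q)"]
    by blast
  have kerA: "(\<Sum>j<p. r j * shared_load \<theta> $$ (j, k)) = 0" if "k < q" for k
    using ker[of k] that by simp
  have kerB: "(\<Sum>j<p. r j * study_load \<theta> s $$ (j, k)) = 0" if "k < m" for k
    using ker[of "q + k"] that by simp
  \<comment> \<open>For \<theta>' the squares coming from the loadings are dropped as nonnegative;
    for \<theta> they vanish by the choice of r.\<close>
  have "noise_var \<theta>' s * (\<Sum>j<p. (r j)\<^sup>2) \<le> (\<Sum>j<p. \<Sum>l<p. r j * r l * latent_cov q m \<theta>' s j l)"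
    unfolding latent_cov_form by (simp add: sum_nonneg)
  also have "\<dots> = (\<Sum>j<p. \<Sum>l<p. r j * r l * latent_cov q m \<theta> s j l)"
    using cov by (intro sum.cong) auto
  also have "\<dots> = noise_var \<theta> s * (\<Sum>j<p. (r j)\<^sup>2)"
    unfolding latent_cov_form by (simp add: kerA kerB)
  finally have le: "noise_var \<theta>' s * (\<Sum>j<p. (r j)\<^sup>2) \<le> noise_var \<theta> s * (\<Sum>j<p. (r j)\<^sup>2)" .
  obtain j where "j < p" "r j \<noteq> 0" using r by blast
  then have "0 < (\<Sum>j<p. (r j)\<^sup>2)" by (intro sum_pos2[of _ j]) auto
  with le show ?thesis by simp
qed

section \<open>Gram matrices and sign convention of concatenated loadings\<close>

lemma concat_cols_carrier:
  "U \<in> carrier_mat p q \<Longrightarrow> V \<in> carrier_mat p m \<Longrightarrow> concat_cols U V \<in> carrier_mat p (q + m)"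
  by (simp add: concat_cols_def)

lemma concat_cols_index:
  assumes "U \<in> carrier_mat p q" "V \<in> carrier_mat p m" "j < p"
  shows "k < q \<Longrightarrow> concat_cols U V $$ (j, k) = U $$ (j, k)"
    and "k < m \<Longrightarrow> concat_cols U V $$ (j, q + k) = V $$ (j, k)"
  using assms by (auto simp: concat_cols_def)

text \<open>This recognises the low-rank part of \<open>latent_cov\<close> as a product W W^T, the
  form required by \<open>gram_factor_unique\<close>.\<close>

lemma concat_cols_gram_index:
  assumes U: "U \<in> carrier_mat p q" and V: "V \<in> carrier_mat p m" and jl: "j < p" "l < p"
  shows "(concat_cols U V * transpose_mat (concat_cols U V)) $$ (j, l) =
    (\<Sum>k<q. U $$ (j, k) * U $$ (l, k)) + (\<Sum>k<m. V $$ (j, k) * V $$ (l, k))"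
  by (simp add: mult_transpose_index[OF concat_cols_carrier[OF U V] jl] sum_lessThan_add
      concat_cols_index[OF U V jl(1)] concat_cols_index[OF U V jl(2)] del: index_mult_mat)

lemma first_nonzero_pos_concat_cols:
  assumes U: "U \<in> carrier_mat p q" and V: "V \<in> carrier_mat p m"
    and "first_nonzero_pos U" "first_nonzero_pos V"
  shows "first_nonzero_pos (concat_cols U V)"
  unfolding first_nonzero_pos_def
proof (intro allI impI)
  fix k j
  assume "k < dim_col (concat_cols U V)" "j < dim_row (concat_cols U V)"
  then have k: "k < q + m" and j: "j < p"
    using concat_cols_carrier[OF U V] by auto
  assume nz: "concat_cols U V $$ (j, k) \<noteq> 0 \<and> (\<forall>l<j. concat_cols U V $$ (l, k) = 0)"
  show "0 < concat_cols U V $$ (j, k)"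
  proof (cases "k < q")
    case True
    with nz j have "U $$ (j, k) \<noteq> 0 \<and> (\<forall>l<j. U $$ (l, k) = 0)"
      by (simp add: concat_cols_index(1)[OF U V])
    with \<open>first_nonzero_pos U\<close> U True j show ?thesis
      unfolding first_nonzero_pos_def by (simp add: concat_cols_index(1)[OF U V])
  next
    case False
    then obtain k' where k': "k = q + k'" "k' < m" using k by (metis le_add_diff_inverse nat_add_left_cancel_less not_less)
    with nz j have "V $$ (j, k') \<noteq> 0 \<and> (\<forall>l<j. V $$ (l, k') = 0)"
      by (simp add: concat_cols_index(2)[OF U V])
    with \<open>first_nonzero_pos V\<close> V k' j show ?thesis
      unfolding first_nonzero_pos_def by (simp add: concat_cols_index(2)[OF U V])
  qed
qed

lemma concat_cols_inject:
  assumes U: "U \<in> carrier_mat p q" and V: "V \<in> carrier_mat p m"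
    and U': "U' \<in> carrier_mat p q" and V': "V' \<in> carrier_mat p m"
    and eq: "concat_cols U V = concat_cols U' V'"
  shows "U = U'" "V = V'"
proof -
  show "U = U'"
    using U U' concat_cols_index(1)[OF U V] concat_cols_index(1)[OF U' V'] eq by (intro eq_matI) auto
  show "V = V'"
    using V V' concat_cols_index(2)[OF U V] concat_cols_index(2)[OF U' V'] eq by (intro eq_matI) auto
qed

theorem theorem1:
  fixes M :: "'w measure" and M' :: "'v measure"
    and S :: nat and n :: "nat \<Rightarrow> nat"
    and p d q :: nat and qs :: "nat \<Rightarrow> nat"
    and a :: "nat \<Rightarrow> nat \<Rightarrow> real"
    and \<theta> \<theta>' :: mparams
    and z f h e :: "nat \<Rightarrow> nat \<Rightarrow> 'w \<Rightarrow> nat \<Rightarrow> real"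
    and z' f' h' e' :: "nat \<Rightarrow> nat \<Rightarrow> 'v \<Rightarrow> nat \<Rightarrow> real"
    and x :: "nat \<Rightarrow> nat \<Rightarrow> 'w \<Rightarrow> nat \<Rightarrow> nat"
    and x' :: "nat \<Rightarrow> nat \<Rightarrow> 'v \<Rightarrow> nat \<Rightarrow> nat"
  assumes "identifiability_conditions M S n p d q qs a \<theta> z f h e x"
    and "identifiability_conditions M' S n p d q qs a \<theta>' z' f' h' e' x'"
    and same_covariate_law: "\<And>s i. s \<in> {1..S} \<Longrightarrow> i \<in> {1..n s} \<Longrightarrow>
      distr M (real_vec_space d) (z s i) = distr M' (real_vec_space d) (z' s i)"
    and same_joint_law: "\<And>s i. s \<in> {1..S} \<Longrightarrow> i \<in> {1..n s} \<Longrightarrow>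
      distr M (count_vec_space p \<Otimes>\<^sub>M real_vec_space d) (\<lambda>\<omega>. (x s i \<omega>, z s i \<omega>)) =
      distr M' (count_vec_space p \<Otimes>\<^sub>M real_vec_space d) (\<lambda>\<omega>. (x' s i \<omega>, z' s i \<omega>))"
  shows "reg_coef \<theta> = reg_coef \<theta>' \<and> shared_load \<theta> = shared_load \<theta>' \<and>
    (\<forall>s \<in> {1..S}. study_load \<theta> s = study_load \<theta>' s \<and> noise_var \<theta> s = noise_var \<theta>' s)"
proof -
  interpret A: identifiability_conditions M S n p d q qs a \<theta> z f h e x by fact
  interpret B: identifiability_conditions M' S n p d q qs a \<theta>' z' f' h' e' x' by fact
  have one: "1 \<in> {1..S}" using A.studies by simp
  \<comment> \<open>One observation per study is enough; the first always exists.\<close>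
  have obs: "1 \<in> {1..n s}" if "s \<in> {1..S}" for s using A.observations[OF that] by simp
  note same = same_law_imp_same_mean_cov[OF assms(1,2) _ obs same_covariate_law[OF _ obs] same_joint_law[OF _ obs]]
  have "reg_coef \<theta> = reg_coef \<theta>'"
    using A.reg_coef_dim B.reg_coef_dim same(1)[OF one one one one]
    A.studies by (intro eq_matI) auto
  have cov: "latent_cov q (qs s) \<theta> s j l = latent_cov q (qs s) \<theta>' s j l"
    if "s \<in> {1..S}" "j < p" "l < p" for s j l
    using same(2)[OF that(1) that(1) that(1) that(1)] that by blast
  \<comment> \<open>The comparison of noise variances is applied in both directions, with the kernel
    vector taken from either model.\<close>
  have noise: "noise_var \<theta> s = noise_var \<theta>' s" if "s \<in> {1..S}" for s
  proof (rule antisym)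
    have "q + qs s < p" using A.A3[OF that] by simp
    then show "noise_var \<theta> s \<le> noise_var \<theta>' s" "noise_var \<theta>' s \<le> noise_var \<theta> s"
      using cov[OF that] by (auto intro!: noise_var_le[where q=q and m="qs s" and p=p])
  qed
  have low_rank:
    "(\<Sum>k<q. shared_load \<theta> $$ (j, k) * shared_load \<theta> $$ (l, k)) +
     (\<Sum>k<qs s. study_load \<theta> s $$ (j, k) * study_load \<theta> s $$ (l, k)) =
     (\<Sum>k<q. shared_load \<theta>' $$ (j, k) * shared_load \<theta>' $$ (l, k)) +
     (\<Sum>k<qs s. study_load \<theta>' s $$ (j, k) * study_load \<theta>' s $$ (l, k))"
    if "s \<in> {1..S}" "j < p" "l < p" for s j l
    using cov[OF that] unfolding latent_cov_def noise[OF that(1)] by (rule add_right_imp_eq)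
  note U = A.shared_load_dim A.study_load_dim[OF one] and U' = B.shared_load_dim B.study_load_dim[OF one]
  \<comment> \<open>In study 1, (A2) concerns the joint matrix (A, B_1), so both blocks are
    recovered together.\<close>
  have "concat_cols (shared_load \<theta>) (study_load \<theta> 1) = concat_cols (shared_load \<theta>') (study_load \<theta>' 1)"
  proof (rule gram_factor_unique[OF concat_cols_carrier[OF U] concat_cols_carrier[OF U']])
    let ?W = "concat_cols (shared_load \<theta>) (study_load \<theta> 1)"
    let ?W' = "concat_cols (shared_load \<theta>') (study_load \<theta>' 1)"
    show "?W * transpose_mat ?W = ?W' * transpose_mat ?W'"
    proof (rule eq_matI)
      fix j l assume "j < dim_row (?W' * transpose_mat ?W')" "l < dim_col (?W' * transpose_mat ?W')"
      then have "j < p" "l < p" using concat_cols_carrier[OF U'] by auto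
      then show "(?W * transpose_mat ?W) $$ (j, l) = (?W' * transpose_mat ?W') $$ (j, l)"
        by (simp only: concat_cols_gram_index[OF U] concat_cols_gram_index[OF U'] low_rank[OF one])
    qed (use concat_cols_carrier[OF U] concat_cols_carrier[OF U'] in auto)
    show "first_nonzero_pos ?W" "first_nonzero_pos ?W'"
      by (rule first_nonzero_pos_concat_cols[OF U A.A2_sign_shared A.A2_sign_study[OF one]]
          first_nonzero_pos_concat_cols[OF U' B.A2_sign_shared B.A2_sign_study[OF one]])+
  qed (use A.A2_joint B.A2_joint in \<open>simp_all add: Let_def\<close>)
  then have shared: "shared_load \<theta> = shared_load \<theta>'" and study1: "study_load \<theta> 1 = study_load \<theta>' 1"
    using concat_cols_inject[OF U U'] by auto
  have study: "study_load \<theta> s = study_load \<theta>' s" if s: "s \<in> {1..S}" for s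
  proof (cases "s = 1")
    case False
    then have s2: "s \<in> {2..S}" using s by simp
    note L = A.study_load_dim[OF s] and L' = B.study_load_dim[OF s]
    show ?thesis
    proof (rule gram_factor_unique[OF L L' _ A.A2_study[OF s2] B.A2_study[OF s2] A.A2_sign_study[OF s] B.A2_sign_study[OF s]])
      \<comment> \<open>With A known from study 1, its contribution A A^T cancels and leaves the
        Gram identity for B_s alone.\<close>
      show "study_load \<theta> s * transpose_mat (study_load \<theta> s) = study_load \<theta>' s * transpose_mat (study_load \<theta>' s)"
      proof (rule eq_matI)
        fix j l assume "j < dim_row (study_load \<theta>' s * transpose_mat (study_load \<theta>' s))"
          "l < dim_col (study_load \<theta>' s * transpose_mat (study_load \<theta>' s))"
        then have jl: "j < p" "l < p" using L' by auto
        show "(study_load \<theta> s * transpose_mat (study_load \<theta> s)) $$ (j, l) =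
            (study_load \<theta>' s * transpose_mat (study_load \<theta>' s)) $$ (j, l)"
          unfolding mult_transpose_index[OF L jl] mult_transpose_index[OF L' jl]
          using low_rank[OF s jl] by (simp add: shared)
      qed (use L L' in auto)
    qed
  qed (use study1 in simp)
  show ?thesis using \<open>reg_coef \<theta> = reg_coef \<theta>'\<close> shared study noise by blast
qed

end
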